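(* Let $A$ be a complex commutative semi-simple regular unital Banach algebra such that $\Delta(A)$ consists of infinitely many points, and let $\sigma : A \rightarrow A$ be an algebra automorphism of $A$. Then $A \rtimes_{\sigma} \mathbb{Z}$ is simple if and only if the naturally induced system $(\Delta(A), \widetilde{\sigma})$, where $\widetilde{\sigma}(\mu) = \mu \circ \sigma^{-1}$ for $\mu \in \Delta(A)$, is minimal.
   Context: $\Delta(A)$ denotes the character space of $A$ (the non-zero complex algebra homomorphisms $A \to \mathbb{C}$) with the Gelfand topology, i.e. the weakest topology making all Gelfand transforms $\widehat{a}$, $\widehat{a}(\mu) = \mu(a)$, $a \in A$, continuous; $\widetilde{\sigma}$ is a homeomorphism of $\Delta(A)$. A commutative Banach algebra $A$ is semi-simple if the Gelfand transform $a \mapsto \widehat{a}$ is injective; it is regular if for every closed $F \subseteq \Delta(A)$ and every $\phi_0 \in \Delta(A) \setminus F$ there is $a \in A$ with $\widehat{a}(\phi) = 0$ for all $\phi \in F$ and $\widehat{a}(\phi_0) \neq 0$. The crossed product $A \rtimes_{\sigma} \mathbb{Z}$ is the purely algebraic one: the set of functions $f : \mathbb{Z} \to A$ with $f(n) = 0$ for all but finitely many $n$, with pointwise addition and scalar multiplication and multiplication given by twisted convolution $(f*g)(n) = \sum_{k \in \mathbb{Z}} f(k) \cdot \sigma^k(g(n-k))$. A topological dynamical system $(\Delta(A), \widetilde{\sigma})$ is minimal if all of its orbits $\{\widetilde{\sigma}^n(\mu) : n \in \mathbb{Z}\}$ are dense. An algebra is simple if it has no non-trivial proper ideals; ideals are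 two-sided (and purely algebraic, no closedness being required). *)

theory Defs
  imports "HOL-Analysis.Analysis" "HOL-Algebra.Module" "HOL-Algebra.Ideal"
begin

text \<open>
  The library has real normed algebras only, so the complex scalar multiplication is added on top
  of the real one. The norm is submultiplicative; \<open>norm 1 = 1\<close> is not required.
\<close>

class complex_comm_banach_algebra = real_normed_algebra + comm_ring_1 + banach +
  fixes scaleC :: "complex \<Rightarrow> 'a \<Rightarrow> 'a"  (infixr \<open>*\<^sub>C\<close> 75)
  assumes scaleC_add_right: "c *\<^sub>C (x + y) = c *\<^sub>C x + c *\<^sub>C y"
    and scaleC_add_left: "(c + d) *\<^sub>C x = c *\<^sub>C x + d *\<^sub>C x"
    and scaleC_scaleC: "c *\<^sub>C (d *\<^sub>C x) = (c * d) *\<^sub>C x"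
    and scaleC_of_real: "complex_of_real r *\<^sub>C x = r *\<^sub>R x"
    and mult_scaleC_left: "(c *\<^sub>C x) * y = c *\<^sub>C (x * y)"
    and norm_scaleC: "norm (c *\<^sub>C x) = cmod c * norm x"

definition character_space :: "('a::complex_comm_banach_algebra \<Rightarrow> complex) set" where
  "character_space = {\<mu>. (\<forall>x y. \<mu> (x + y) = \<mu> x + \<mu> y) \<and> (\<forall>c x. \<mu> (c *\<^sub>C x) = c * \<mu> x) \<and>
     (\<forall>x y. \<mu> (x * y) = \<mu> x * \<mu> y) \<and> (\<exists>x. \<mu> x \<noteq> 0)}"

definition gelfand_transform ::
  "'a::complex_comm_banach_algebra \<Rightarrow> ('a \<Rightarrow> complex) \<Rightarrow> complex" where
  "gelfand_transform a = restrict (\<lambda>\<mu>. \<mu> a) character_space"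

definition gelfand_topology :: "('a::complex_comm_banach_algebra \<Rightarrow> complex) topology" where
  "gelfand_topology = topology_generated_by
     {gelfand_transform a -` U \<inter> character_space | a U. open U}"

definition semisimple_algebra :: "'a::complex_comm_banach_algebra itself \<Rightarrow> bool" where
  "semisimple_algebra _ \<longleftrightarrow> inj (gelfand_transform :: 'a \<Rightarrow> ('a \<Rightarrow> complex) \<Rightarrow> complex)"

definition regular_algebra :: "'a::complex_comm_banach_algebra itself \<Rightarrow> bool" where
  "regular_algebra _ \<longleftrightarrow>
     (\<forall>F (\<phi>0 :: 'a \<Rightarrow> complex). closedin gelfand_topology F \<and> \<phi>0 \<in> character_space - F \<longrightarrow>
        (\<exists>a. (\<forall>\<phi>\<in>F. gelfand_transform a \<phi> = 0) \<and> gelfand_transform a \<phi>0 \<noteq> 0))"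

definition algebra_automorphism :: "('a::complex_comm_banach_algebra \<Rightarrow> 'a) \<Rightarrow> bool" where
  "algebra_automorphism \<sigma> \<longleftrightarrow> bij \<sigma> \<and> (\<forall>x y. \<sigma> (x + y) = \<sigma> x + \<sigma> y) \<and>
     (\<forall>c x. \<sigma> (c *\<^sub>C x) = c *\<^sub>C \<sigma> x) \<and> (\<forall>x y. \<sigma> (x * y) = \<sigma> x * \<sigma> y)"

text \<open>Integer powers of a bijection \<open>f\<close> of \<open>S\<close> onto itself.\<close>

definition int_iterate :: "'b set \<Rightarrow> ('b \<Rightarrow> 'b) \<Rightarrow> int \<Rightarrow> 'b \<Rightarrow> 'b" where
  "int_iterate S f k = (if 0 \<le> k then f ^^ nat k else inv_into S f ^^ nat (- k))"

definition minimal_system :: "'b topology \<Rightarrow> ('b \<Rightarrow> 'b) \<Rightarrow> bool" where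
  "minimal_system X f \<longleftrightarrow>
     (\<forall>x\<in>topspace X. Abstract_Topology.closure_of X (range (\<lambda>n. int_iterate (topspace X) f n x)) = topspace X)"

definition induced_map :: "('a \<Rightarrow> 'a) \<Rightarrow> ('a \<Rightarrow> complex) \<Rightarrow> ('a \<Rightarrow> complex)" where
  "induced_map \<sigma> \<mu> = \<mu> \<circ> inv_into UNIV \<sigma>"

text \<open>The sum over all integers \<open>k\<close> is finite: only the support of \<open>f\<close> contributes.\<close>

definition twisted_convolution ::
  "('a::complex_comm_banach_algebra \<Rightarrow> 'a) \<Rightarrow> (int \<Rightarrow> 'a) \<Rightarrow> (int \<Rightarrow> 'a) \<Rightarrow> int \<Rightarrow> 'a" where
  "twisted_convolution \<sigma> f g n =
     (\<Sum>k\<in>{k. f k \<noteq> 0}. f k * int_iterate UNIV \<sigma> k (g (n - k)))"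

definition crossed_product ::
  "('a::complex_comm_banach_algebra \<Rightarrow> 'a) \<Rightarrow> (complex, int \<Rightarrow> 'a) module" where
  "crossed_product \<sigma> =
     \<lparr>carrier = {f. finite {n. f n \<noteq> 0}},
      monoid.mult = twisted_convolution \<sigma>,
      one = (\<lambda>n. if n = 0 then 1 else 0),
      zero = (\<lambda>n. 0),
      add = (\<lambda>f g n. f n + g n),
      smult = (\<lambda>c f n. c *\<^sub>C f n)\<rparr>"

text \<open>
  Algebra ideals are two-sided ring ideals that are linear subspaces (for unital algebras the
  latter is automatic). The scalars here are the whole type of complex numbers.
\<close>

definition algebra_ideal :: "'b set \<Rightarrow> (complex, 'b) module \<Rightarrow> bool" where
  "algebra_ideal I B \<longleftrightarrow> ideal I B \<and> (\<forall>c. \<forall>x\<in>I. c \<odot>\<^bsub>B\<^esub> x \<in> I)"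

definition simple_algebra :: "(complex, 'b) module \<Rightarrow> bool" where
  "simple_algebra B \<longleftrightarrow> (\<forall>I. algebra_ideal I B \<longrightarrow> I = {\<zero>\<^bsub>B\<^esub>} \<or> I = carrier B)"

lemma topspace_gelfand_topology: "topspace gelfand_topology = character_space"
proof -
  have "character_space \<in> {gelfand_transform a -` U \<inter> character_space | a U. open U}"
    by (rule CollectI, rule exI[of _ 0], rule exI[of _ UNIV]) auto
  then show ?thesis
    unfolding gelfand_topology_def topology_generated_by_topspace by blast
qed

lemma continuous_map_gelfand_transform:
  "continuous_map gelfand_topology euclidean (gelfand_transform a)"
proof -
  have "openin gelfand_topology {x \<in> topspace gelfand_topology. gelfand_transform a x \<in> U}"
    if "open U" for U
  proof -
    have "{x \<in> topspace gelfand_topology. gelfand_transform a x \<in> U} =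
        gelfand_transform a -` U \<inter> character_space"
      by (auto simp: topspace_gelfand_topology)
    then show ?thesis
      using that unfolding gelfand_topology_def
      by (auto intro!: topology_generated_by_Basis)
  qed
  then show ?thesis by (auto simp: continuous_map_def)
qed

lemma gelfand_topology_weakest:
  assumes "topspace X = character_space"
    and "\<And>a. continuous_map X euclidean (gelfand_transform a)"
    and "openin gelfand_topology V"
  shows "openin X V"
proof -
  have "openin X (gelfand_transform a -` U \<inter> character_space)" if "open U" for a U
  proof -
    have "{x \<in> topspace X. gelfand_transform a x \<in> U} = gelfand_transform a -` U \<inter> character_space"
      by (auto simp: assms(1))
    then show ?thesis
      using openin_continuous_map_preimage[OF assms(2), of U a] that by simp
  qed
  then have "openin X V" if "generate_topology_on {gelfand_transform a -` U \<inter> character_space | a U. open U} V"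
    using that by (rule_tac generate_topology_on_coarsest[OF istopology_openin _ that]) auto
  then show ?thesis
    using assms(3) by (simp add: gelfand_topology_def openin_topology_generated_by_iff)
qed

lemma induced_map_bij:
  assumes "algebra_automorphism \<sigma>"
  shows "bij_betw (induced_map \<sigma>) character_space character_space"
proof -
  have b: "bij \<sigma>" and
    h: "\<And>x y. \<sigma> (x + y) = \<sigma> x + \<sigma> y" "\<And>c x. \<sigma> (c *\<^sub>C x) = c *\<^sub>C \<sigma> x" "\<And>x y. \<sigma> (x * y) = \<sigma> x * \<sigma> y"
    using assms by (auto simp: algebra_automorphism_def)
  have si: "\<sigma> (inv_into UNIV \<sigma> x) = x" "inv_into UNIV \<sigma> (\<sigma> x) = x" for x
    using b by (simp_all add: bij_is_surj surj_f_inv_f bij_is_inj)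
  have i: "inv_into UNIV \<sigma> (x + y) = inv_into UNIV \<sigma> x + inv_into UNIV \<sigma> y" "inv_into UNIV \<sigma> (c *\<^sub>C x) = c *\<^sub>C inv_into UNIV \<sigma> x"
    "inv_into UNIV \<sigma> (x * y) = inv_into UNIV \<sigma> x * inv_into UNIV \<sigma> y" for x y c
    by (metis h si)+
  show ?thesis
  proof (rule bij_betwI[where g = "\<lambda>\<mu>. \<mu> \<circ> \<sigma>"])
    show "induced_map \<sigma> \<in> character_space \<rightarrow> character_space"
      by (auto simp: induced_map_def character_space_def i) (metis si(2))
    show "(\<lambda>\<mu>. \<mu> \<circ> \<sigma>) \<in> character_space \<rightarrow> character_space"
      by (auto simp: character_space_def h) (metis si(1))
  qed (auto simp: induced_map_def si fun_eq_iff)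
qed

lemma int_iterate_Suc:
  assumes "bij f"
  shows "int_iterate UNIV f (k + 1) x = f (int_iterate UNIV f k x)"
proof (cases "0 \<le> k")
  case True
  then have "nat (k + 1) = Suc (nat k)" by simp
  with True show ?thesis by (simp add: int_iterate_def)
next
  case False
  then have *: "nat (- k) = Suc (nat (- (k + 1)))" by simp
  have "f (inv_into UNIV f y) = y" for y using assms by (simp add: bij_is_surj surj_f_inv_f)
  then show ?thesis using False by (cases "k = - 1") (simp_all add: int_iterate_def *)
qed

lemma int_iterate_add:
  assumes "bij f"
  shows "int_iterate UNIV f (a + b) x = int_iterate UNIV f a (int_iterate UNIV f b x)"
proof (induction a rule: int_induct[where k = 0])
  case base
  then show ?case by (simp add: int_iterate_def)
next
  case (step1 i)
  then show ?case
    using int_iterate_Suc[OF assms, of "i + b" x]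
      int_iterate_Suc[OF assms, of i "int_iterate UNIV f b x"]
    by (simp add: algebra_simps)
next
  case (step2 i)
  have "f (int_iterate UNIV f (i - 1 + b) x) =
      f (int_iterate UNIV f (i - 1) (int_iterate UNIV f b x))"
    using step2 int_iterate_Suc[OF assms, of "i - 1 + b" x]
      int_iterate_Suc[OF assms, of "i - 1" "int_iterate UNIV f b x"]
    by (simp add: algebra_simps)
  then show ?case using assms by (meson bij_is_inj injD)
qed

lemma int_iterate_hom:
  assumes "algebra_automorphism \<sigma>"
  shows "int_iterate UNIV \<sigma> k (x + y) = int_iterate UNIV \<sigma> k x + int_iterate UNIV \<sigma> k y"
    and "int_iterate UNIV \<sigma> k (x * y) = int_iterate UNIV \<sigma> k x * int_iterate UNIV \<sigma> k y"
proof -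
  have b: "bij \<sigma>" and
    h: "\<And>x y. \<sigma> (x + y) = \<sigma> x + \<sigma> y" "\<And>x y. \<sigma> (x * y) = \<sigma> x * \<sigma> y"
    using assms by (auto simp: algebra_automorphism_def)
  have si: "\<sigma> (inv_into UNIV \<sigma> x) = x" "inv_into UNIV \<sigma> (\<sigma> x) = x" for x
    using b by (simp_all add: bij_is_surj surj_f_inv_f bij_is_inj)
  have i: "inv_into UNIV \<sigma> (x + y) = inv_into UNIV \<sigma> x + inv_into UNIV \<sigma> y" "inv_into UNIV \<sigma> (x * y) = inv_into UNIV \<sigma> x * inv_into UNIV \<sigma> y" for x y
    by (metis h si)+
  have p: "(\<sigma> ^^ n) (x + y) = (\<sigma> ^^ n) x + (\<sigma> ^^ n) y" "(\<sigma> ^^ n) (x * y) = (\<sigma> ^^ n) x * (\<sigma> ^^ n) y"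
    "(inv_into UNIV \<sigma> ^^ n) (x + y) = (inv_into UNIV \<sigma> ^^ n) x + (inv_into UNIV \<sigma> ^^ n) y"
    "(inv_into UNIV \<sigma> ^^ n) (x * y) = (inv_into UNIV \<sigma> ^^ n) x * (inv_into UNIV \<sigma> ^^ n) y" for n
    by (induction n) (simp_all add: h i)
  show "int_iterate UNIV \<sigma> k (x + y) = int_iterate UNIV \<sigma> k x + int_iterate UNIV \<sigma> k y"
    "int_iterate UNIV \<sigma> k (x * y) = int_iterate UNIV \<sigma> k x * int_iterate UNIV \<sigma> k y"
    by (simp_all add: int_iterate_def p)
qed

lemma twisted_convolution_sum:
  assumes "finite S" "{k. f k \<noteq> 0} \<subseteq> S"
  shows "twisted_convolution \<sigma> f g n = (\<Sum>k\<in>S. f k * int_iterate UNIV \<sigma> k (g (n - k)))"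
  unfolding twisted_convolution_def by (rule sum.mono_neutral_left) (use assms in auto)

text \<open>
  The predicate \<open>ideal\<close> of the library requires the ambient structure to be a ring, so the
  following lemma rules out that simplicity holds vacuously.
\<close>

lemma ring_crossed_product:
  assumes "algebra_automorphism \<sigma>"
  shows "ring (crossed_product \<sigma>)"
proof -
  let ?s = "int_iterate UNIV \<sigma>"
  let ?S = "\<lambda>f :: int \<Rightarrow> 'a. {n. f n \<noteq> 0}"
  note hom = int_iterate_hom[OF assms]
  have b: "bij \<sigma>" using assms by (simp add: algebra_automorphism_def)
  have s0: "?s k 0 = 0" for k using hom(1)[of k 0 0] by simp
  have ssum: "?s k (sum h A) = (\<Sum>j\<in>A. ?s k (h j))" for k A and h :: "int \<Rightarrow> 'a"
    by (induction A rule: infinite_finite_induct) (simp_all add: s0 hom)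
  have id0: "?s 0 x = x" for x by (simp add: int_iterate_def)
  have sinv: "?s k (?s (- k) x) = x" for k x
    using int_iterate_add[OF b, of k "- k" x] by (simp add: id0)
  have s1: "?s k 1 = 1" for k
  proof -
    have "?s k 1 = ?s k 1 * ?s k (?s (- k) 1)" by (simp add: sinv)
    also have "\<dots> = ?s k (1 * ?s (- k) 1)" by (simp only: hom)
    finally show ?thesis by (simp add: sinv)
  qed
  have supp: "?S (twisted_convolution \<sigma> f g) \<subseteq> (\<lambda>(i, j). i + j) ` (?S f \<times> ?S g)" for f g
  proof
    fix n assume "n \<in> ?S (twisted_convolution \<sigma> f g)"
    then have "twisted_convolution \<sigma> f g n \<noteq> 0" by simp
    then obtain k where k: "f k \<noteq> 0" "f k * ?s k (g (n - k)) \<noteq> 0"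
      unfolding twisted_convolution_def by (rule sum.not_neutral_contains_not_neutral) blast
    then have "g (n - k) \<noteq> 0" using s0 by auto
    then show "n \<in> (\<lambda>(i, j). i + j) ` (?S f \<times> ?S g)"
      using k(1) by (intro image_eqI[of _ _ "(k, n - k)"]) auto
  qed
  have fin: "finite (?S (twisted_convolution \<sigma> f g))" if "finite (?S f)" "finite (?S g)" for f g
    using that by (intro finite_subset[OF supp]) auto
  have finadd: "finite (?S (\<lambda>n. f n + g n))" if "finite (?S f)" "finite (?S g)" for f g
    by (rule finite_subset[of _ "?S f \<union> ?S g"]) (use that in auto)
  have assoc: "twisted_convolution \<sigma> (twisted_convolution \<sigma> f g) h n =
      twisted_convolution \<sigma> f (twisted_convolution \<sigma> g h) n"
    if f: "finite (?S f)" and g: "finite (?S g)" for f g h n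
  proof -
    define M where "M = (\<lambda>(i, j). i + j) ` (?S f \<times> ?S g)"
    have M: "finite M" using f g by (simp add: M_def)
    have "twisted_convolution \<sigma> (twisted_convolution \<sigma> f g) h n =
        (\<Sum>m\<in>M. twisted_convolution \<sigma> f g m * ?s m (h (n - m)))"
      by (rule twisted_convolution_sum) (use M supp[of f g] in \<open>auto simp: M_def\<close>)
    also have "\<dots> = (\<Sum>m\<in>M. \<Sum>k\<in>?S f. f k * ?s k (g (m - k)) * ?s m (h (n - m)))"
      by (simp add: twisted_convolution_def sum_distrib_right)
    also have "\<dots> = (\<Sum>k\<in>?S f. \<Sum>m\<in>M. f k * ?s k (g (m - k)) * ?s m (h (n - m)))"
      by (rule sum.swap)
    also have "\<dots> = (\<Sum>k\<in>?S f. \<Sum>j\<in>?S g. f k * ?s k (g j) * ?s (k + j) (h (n - (k + j))))"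
    proof (rule sum.cong[OF refl])
      fix k assume k: "k \<in> ?S f"
      have "(\<Sum>m\<in>M. f k * ?s k (g (m - k)) * ?s m (h (n - m))) =
          (\<Sum>m\<in>(+) k ` ?S g. f k * ?s k (g (m - k)) * ?s m (h (n - m)))"
      proof (rule sum.mono_neutral_right[OF M])
        show "(+) k ` ?S g \<subseteq> M" using k by (auto simp: M_def)
        show "\<forall>m\<in>M - (+) k ` ?S g. f k * ?s k (g (m - k)) * ?s m (h (n - m)) = 0"
        proof
          fix m assume m: "m \<in> M - (+) k ` ?S g"
          have "g (m - k) = 0"
          proof (rule ccontr)
            assume "g (m - k) \<noteq> 0"
            then have "m \<in> (+) k ` ?S g" by (intro image_eqI[of _ _ "m - k"]) auto
            with m show False by simp
          qed
          then show "f k * ?s k (g (m - k)) * ?s m (h (n - m)) = 0" by (simp add: s0)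
        qed
      qed
      also have "\<dots> = (\<Sum>j\<in>?S g. f k * ?s k (g j) * ?s (k + j) (h (n - (k + j))))"
        by (subst sum.reindex) (auto simp: inj_on_def)
      finally show "(\<Sum>m\<in>M. f k * ?s k (g (m - k)) * ?s m (h (n - m))) =
        (\<Sum>j\<in>?S g. f k * ?s k (g j) * ?s (k + j) (h (n - (k + j))))" .
    qed
    also have "\<dots> = twisted_convolution \<sigma> f (twisted_convolution \<sigma> g h) n"
      by (simp add: twisted_convolution_def sum_distrib_left ssum hom int_iterate_add[OF b]
            mult.assoc diff_diff_eq)
    finally show ?thesis .
  qed
  have distl: "twisted_convolution \<sigma> (\<lambda>n. f n + g n) h n =
      twisted_convolution \<sigma> f h n + twisted_convolution \<sigma> g h n"
    if "finite (?S f)" "finite (?S g)" for f g h n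
  proof -
    have "finite (?S f \<union> ?S g)" using that by simp
    note * = twisted_convolution_sum[OF this, where \<sigma> = \<sigma> and g = h and n = n]
    have "twisted_convolution \<sigma> (\<lambda>n. f n + g n) h n =
        (\<Sum>k\<in>?S f \<union> ?S g. (f k + g k) * ?s k (h (n - k)))"
      by (rule *) auto
    also have "\<dots> = (\<Sum>k\<in>?S f \<union> ?S g. f k * ?s k (h (n - k))) +
        (\<Sum>k\<in>?S f \<union> ?S g. g k * ?s k (h (n - k)))"
      by (simp add: distrib_right sum.distrib)
    also have "\<dots> = twisted_convolution \<sigma> f h n + twisted_convolution \<sigma> g h n"
      by (subst (1 2) *) auto
    finally show ?thesis .
  qed
  have distr: "twisted_convolution \<sigma> h (\<lambda>n. f n + g n) n =
      twisted_convolution \<sigma> h f n + twisted_convolution \<sigma> h g n" for f g h n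
    by (simp add: twisted_convolution_def hom distrib_left sum.distrib)
  have one: "twisted_convolution \<sigma> (\<lambda>n. if n = 0 then 1 else 0) f n = f n" for f n
    by (subst twisted_convolution_sum[of "{0}"]) (auto simp: id0)
  have one': "twisted_convolution \<sigma> f (\<lambda>n. if n = 0 then 1 else 0) n = f n"
    if "finite (?S f)" for f n
  proof -
    have "twisted_convolution \<sigma> f (\<lambda>n. if n = 0 then 1 else 0) n =
        (\<Sum>k\<in>insert n (?S f). f k * ?s k (if n - k = 0 then 1 else 0))"
      by (rule twisted_convolution_sum) (use that in auto)
    also have "\<dots> = (\<Sum>k\<in>insert n (?S f). if k = n then f k else 0)"
      by (rule sum.cong) (auto simp: s0 s1)
    also have "\<dots> = f n"
      using that by (subst sum.delta) auto
    finally show ?thesis .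
  qed
  show ?thesis
  proof (rule ringI)
    show "abelian_group (crossed_product \<sigma>)"
    proof (rule abelian_groupI)
      fix x assume "x \<in> carrier (crossed_product \<sigma>)"
      then show "\<exists>y\<in>carrier (crossed_product \<sigma>). y \<oplus>\<^bsub>crossed_product \<sigma>\<^esub> x = \<zero>\<^bsub>crossed_product \<sigma>\<^esub>"
        by (intro bexI[of _ "\<lambda>n. - x n"]) (auto simp: crossed_product_def)
    qed (auto simp: crossed_product_def finadd algebra_simps)
    show "Group.monoid (crossed_product \<sigma>)"
      by (rule Group.monoidI) (auto simp: crossed_product_def fin assoc one one' fun_eq_iff)
  qed (auto simp: crossed_product_def distl distr)
qed

end

theory Submission
  imports Defs
begin

text \<open>
  Because zero sets of Gelfand transforms are closed and, by regularity, separate points from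
  closed sets, minimality says exactly that an element \<open>b\<close> of the algebra whose transform vanishes
  on one orbit is \<open>0\<close> (\<open>minimal_system_iff_vanishing\<close>). What remains is algebra.

  If this fails for \<open>\<mu>\<close>, the elements that vanish on the orbit of \<open>\<mu>\<close> form a
  \<open>\<sigma>\<close>-invariant non-zero proper ideal \<open>J\<close>, and the functions with values in \<open>J\<close> form an ideal of the
  crossed product that is neither zero nor everything (\<open>simple_imp_vanishing\<close>).

  Conversely, an infinite minimal system has no periodic points (\<open>no_periodic_character\<close>). In a
  non-zero ideal \<open>I\<close> of the crossed product take \<open>f\<close> with the fewest non-zero coefficients, say
  \<open>f m \<noteq> 0\<close>. The twisted commutator of \<open>f\<close> with a coefficient \<open>a\<close>, arranged to kill the \<open>m\<close>-th
  coefficient, has coefficients \<open>f n * (a - \<sigma>\<^sup>n\<^sup>-\<^sup>m a)\<close> and smaller support, so it is zero. Since no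
  character is periodic, \<open>f n = 0\<close> for \<open>n \<noteq> m\<close>. Hence \<open>I\<close> contains a non-zero coefficient
  \<open>c\<close> (\<open>nonzero_ideal_meets_coefficients\<close>). The coefficients in \<open>I\<close> form a \<open>\<sigma>\<close>-invariant ideal
  \<open>J\<close> of the algebra. If it were proper, some character would vanish on it
  (\<open>character_vanishing_on_proper_ideal\<close>), hence \<open>c\<close> would vanish on an orbit, contradicting
  minimality. So \<open>1 \<in> J\<close> and \<open>I\<close> is everything.

  The existence of that character is Gelfand theory. A maximal ideal \<open>M\<close> contains \<open>a - \<lambda>1\<close> for some
  \<open>\<lambda>\<close>, for each \<open>a\<close>, because spectra modulo \<open>M\<close> are non-empty (\<open>spectrum_nonempty\<close>). The quotient
  by \<open>M\<close> depends on a term and so is not a type; its norm is therefore replaced by the seminorm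
  \<open>infdist x M\<close> on the algebra itself, and equality in the quotient by \<open>q (x - y) = 0\<close>. Rickart's
  averaging over roots of unity proves non-emptiness of the spectrum for every submultiplicative
  seminorm with \<open>q 1 > 0\<close>; it replaces the usual appeal to Liouville's theorem by finite sums.
\<close>

section \<open>Complex scalars\<close>

lemma scaleC_zero_left [simp]: "0 *\<^sub>C x = (0::'a::complex_comm_banach_algebra)"
  using scaleC_of_real[of 0 x] by simp

lemma scaleC_one [simp]: "1 *\<^sub>C x = (x::'a::complex_comm_banach_algebra)"
  using scaleC_of_real[of 1 x] by simp

lemma scaleC_minus_left: "(- c) *\<^sub>C x = - (c *\<^sub>C (x::'a::complex_comm_banach_algebra))"
  using scaleC_add_left[of c "- c" x] by (simp add: eq_neg_iff_add_eq_0 add.commute)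

lemma scaleC_diff_left: "(c - d) *\<^sub>C x = c *\<^sub>C x - d *\<^sub>C (x::'a::complex_comm_banach_algebra)"
  using scaleC_add_left[of c "- d" x] by (simp add: scaleC_minus_left)

lemma scaleC_sum_left:
  "(\<Sum>i\<in>S. c i) *\<^sub>C x = (\<Sum>i\<in>S. c i *\<^sub>C (x::'a::complex_comm_banach_algebra))"
  by (induction S rule: infinite_finite_induct) (simp_all add: scaleC_add_left)

lemma scaleC_conv_mult: "c *\<^sub>C x = (c *\<^sub>C 1) * (x::'a::complex_comm_banach_algebra)"
  by (simp add: mult_scaleC_left)

lemma scaleC_1_mult: "(c *\<^sub>C 1) * (d *\<^sub>C 1) = (c * d) *\<^sub>C (1::'a::complex_comm_banach_algebra)"
  by (simp add: mult_scaleC_left scaleC_scaleC)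

lemma scaleC_1_power: "(c *\<^sub>C 1) ^ n = (c ^ n) *\<^sub>C (1::'a::complex_comm_banach_algebra)"
  by (induction n) (simp_all add: scaleC_1_mult)

section \<open>Characters and automorphisms\<close>

lemma characterD:
  assumes "\<mu> \<in> character_space"
  shows character_add: "\<mu> (x + y) = \<mu> x + \<mu> y"
    and character_scaleC: "\<mu> (c *\<^sub>C x) = c * \<mu> x"
    and character_mult: "\<mu> (x * y) = \<mu> x * \<mu> y"
    and character_zero: "\<mu> 0 = 0"
    and character_one: "\<mu> 1 = 1"
    and character_diff: "\<mu> (x - y) = \<mu> x - \<mu> y"
proof -
  show add: "\<mu> (x + y) = \<mu> x + \<mu> y" for x y
    using assms by (simp add: character_space_def)
  show "\<mu> (c *\<^sub>C x) = c * \<mu> x"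
    using assms by (simp add: character_space_def)
  show mult: "\<mu> (x * y) = \<mu> x * \<mu> y" for x y
    using assms by (simp add: character_space_def)
  show "\<mu> 0 = 0" using add[of 0 0] by simp
  obtain z where "\<mu> z \<noteq> 0" using assms by (auto simp: character_space_def)
  then show "\<mu> 1 = 1" using mult[of z 1] by simp
  show "\<mu> (x - y) = \<mu> x - \<mu> y" using add[of "x - y" y] by simp
qed

lemma semisimple_eq_zero:
  fixes a :: "'a::complex_comm_banach_algebra"
  assumes "semisimple_algebra TYPE('a)" "\<And>\<mu>. \<mu> \<in> character_space \<Longrightarrow> \<mu> a = 0"
  shows "a = 0"
proof -
  have "gelfand_transform a = gelfand_transform 0"
    using assms(2) by (auto simp: gelfand_transform_def character_zero)
  then show ?thesis
    using assms(1) by (auto simp: semisimple_algebra_def dest: injD)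
qed

lemma int_iterate_0 [simp]: "int_iterate S f 0 x = x"
  by (simp add: int_iterate_def)

lemma int_iterate_minus_cancel:
  assumes "bij f"
  shows "int_iterate UNIV f k (int_iterate UNIV f (- k) x) = x"
  using int_iterate_add[OF assms, of k "- k" x] by simp

context
  fixes \<sigma> :: "'a::complex_comm_banach_algebra \<Rightarrow> 'a"
  assumes \<sigma>: "algebra_automorphism \<sigma>"
begin

lemma automorphism_bij: "bij \<sigma>"
  using \<sigma> by (simp add: algebra_automorphism_def)

lemma iterate_zero: "int_iterate UNIV \<sigma> k 0 = 0"
  using int_iterate_hom(1)[OF \<sigma>, of k 0 0] by simp

lemma iterate_one: "int_iterate UNIV \<sigma> k 1 = 1"
  by (metis automorphism_bij int_iterate_minus_cancel int_iterate_hom(2)[OF \<sigma>]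
      mult.right_neutral mult.left_neutral)

lemma iterate_scaleC: "int_iterate UNIV \<sigma> k (c *\<^sub>C x) = c *\<^sub>C int_iterate UNIV \<sigma> k x"
proof -
  have s: "\<sigma> (c *\<^sub>C x) = c *\<^sub>C \<sigma> x" for x
    using \<sigma> by (simp add: algebra_automorphism_def)
  have i: "inv_into UNIV \<sigma> (c *\<^sub>C x) = c *\<^sub>C inv_into UNIV \<sigma> x" for x
    by (metis s automorphism_bij bij_inv_eq_iff)
  have "(\<sigma> ^^ n) (c *\<^sub>C x) = c *\<^sub>C (\<sigma> ^^ n) x"
    "(inv_into UNIV \<sigma> ^^ n) (c *\<^sub>C x) = c *\<^sub>C (inv_into UNIV \<sigma> ^^ n) x" for n
    by (induction n) (simp_all add: s i)
  then show ?thesis by (simp add: int_iterate_def)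
qed

lemma character_iterate:
  assumes "\<mu> \<in> character_space"
  shows "\<mu> \<circ> int_iterate UNIV \<sigma> k \<in> character_space"
proof -
  have "\<exists>x. \<mu> (int_iterate UNIV \<sigma> k x) \<noteq> 0"
    by (rule exI[of _ 1]) (simp add: iterate_one character_one[OF assms])
  then show ?thesis
    using characterD[OF assms]
    by (simp add: character_space_def int_iterate_hom[OF \<sigma>] iterate_scaleC)
qed

text \<open>
  The sign comes from the definition of the induced map by \<open>\<sigma>\<close> inverse; it disappears once the
  whole orbit is considered.
\<close>

lemma induced_map_iterate:
  assumes "\<mu> \<in> character_space"
  shows "int_iterate character_space (induced_map \<sigma>) n \<mu> = \<mu> \<circ> int_iterate UNIV \<sigma> (- n)"
proof -
  have pos: "(induced_map \<sigma> ^^ k) \<mu> = \<mu> \<circ> (inv_into UNIV \<sigma> ^^ k)" for k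
    by (induction k) (simp_all add: induced_map_def fun_eq_iff funpow_swap1)
  have inv: "inv_into character_space (induced_map \<sigma>) \<nu> = \<nu> \<circ> \<sigma>"
    if "\<nu> \<in> character_space" for \<nu>
  proof (rule inv_into_f_eq)
    show "inj_on (induced_map \<sigma>) character_space"
      using induced_map_bij[OF \<sigma>] by (simp add: bij_betw_def)
    show "\<nu> \<circ> \<sigma> \<in> character_space"
      using character_iterate[OF that, of 1] by (simp add: int_iterate_def)
    show "induced_map \<sigma> (\<nu> \<circ> \<sigma>) = \<nu>"
      by (simp add: induced_map_def fun_eq_iff automorphism_bij bij_is_surj surj_f_inv_f)
  qed
  have neg: "(inv_into character_space (induced_map \<sigma>) ^^ k) \<mu> = \<mu> \<circ> (\<sigma> ^^ k)" for k
  proof (induction k)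
    case (Suc k)
    have k: "\<mu> \<circ> (\<sigma> ^^ k) \<in> character_space"
      using character_iterate[OF assms, of "int k"] by (simp add: int_iterate_def)
    have "(inv_into character_space (induced_map \<sigma>) ^^ Suc k) \<mu>
        = inv_into character_space (induced_map \<sigma>)
            ((inv_into character_space (induced_map \<sigma>) ^^ k) \<mu>)"
      by simp
    also have "\<dots> = inv_into character_space (induced_map \<sigma>) (\<mu> \<circ> (\<sigma> ^^ k))"
      by (simp only: Suc)
    also have "\<dots> = \<mu> \<circ> (\<sigma> ^^ k) \<circ> \<sigma>" by (rule inv[OF k])
    finally show ?case by (simp add: fun_eq_iff funpow_swap1)
  qed simp
  show ?thesis by (cases "n = 0") (simp_all add: int_iterate_def pos neg)
qed

text \<open>
  The zero set of a Gelfand transform is closed, so an element that vanishes on a dense orbit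
  vanishes everywhere. If an orbit is not dense, regularity gives an element that vanishes on its
  closure but not at a chosen character outside.
\<close>

lemma minimal_system_iff_vanishing:
  assumes "semisimple_algebra TYPE('a)" "regular_algebra TYPE('a)"
  shows "minimal_system gelfand_topology (induced_map \<sigma>) \<longleftrightarrow>
    (\<forall>\<mu>\<in>character_space. \<forall>b. (\<forall>k. \<mu> (int_iterate UNIV \<sigma> k b) = 0) \<longrightarrow> b = 0)"
proof -
  let ?orb = "\<lambda>\<mu>. range (\<lambda>n. int_iterate character_space (induced_map \<sigma>) n \<mu>)"
  have orb: "?orb \<mu> = range (\<lambda>k. \<mu> \<circ> int_iterate UNIV \<sigma> k)" if "\<mu> \<in> character_space" for \<mu>
  proof -
    have "?orb \<mu> = (\<lambda>k. \<mu> \<circ> int_iterate UNIV \<sigma> k) ` range uminus"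
      by (simp only: induced_map_iterate[OF that] image_image)
    then show ?thesis by simp
  qed
  show ?thesis
  proof (intro iffI ballI allI impI)
    fix \<mu> b
    assume min: "minimal_system gelfand_topology (induced_map \<sigma>)"
      and \<mu>: "\<mu> \<in> character_space" and z: "\<forall>k. \<mu> (int_iterate UNIV \<sigma> k b) = 0"
    show "b = 0"
    proof (rule semisimple_eq_zero[OF assms(1)], rule ccontr)
      fix \<phi> :: "'a \<Rightarrow> complex" assume \<phi>: "\<phi> \<in> character_space" "\<phi> b \<noteq> 0"
      define T where "T = {\<psi> \<in> topspace gelfand_topology. gelfand_transform b \<psi> \<in> - {0}}"
      have "openin gelfand_topology T"
        unfolding T_def
        by (rule openin_continuous_map_preimage[OF continuous_map_gelfand_transform]) auto
      moreover have "\<phi> \<in> T"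
        using \<phi> by (simp add: T_def topspace_gelfand_topology gelfand_transform_def)
      moreover have "\<phi> \<in> gelfand_topology closure_of ?orb \<mu>"
        using min \<mu> \<phi> by (simp add: minimal_system_def topspace_gelfand_topology)
      ultimately obtain \<psi> where "\<psi> \<in> ?orb \<mu>" "\<psi> \<in> T"
        unfolding in_closure_of by blast
      then show False
        using z unfolding orb[OF \<mu>]
        by (auto simp: T_def topspace_gelfand_topology gelfand_transform_def)
    qed
  next
    assume van: "\<forall>\<mu>\<in>character_space. \<forall>b. (\<forall>k. \<mu> (int_iterate UNIV \<sigma> k b) = 0) \<longrightarrow> b = 0"
    show "minimal_system gelfand_topology (induced_map \<sigma>)"
      unfolding minimal_system_def topspace_gelfand_topology
    proof
      fix \<mu> :: "'a \<Rightarrow> complex" assume \<mu>: "\<mu> \<in> character_space"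
      let ?F = "gelfand_topology closure_of ?orb \<mu>"
      have sub: "?orb \<mu> \<subseteq> character_space"
        using character_iterate[OF \<mu>] by (auto simp: orb[OF \<mu>])
      then have orbF: "?orb \<mu> \<subseteq> ?F"
        by (intro closure_of_subset) (simp add: topspace_gelfand_topology)
      have "character_space \<subseteq> ?F"
      proof (rule ccontr)
        assume "\<not> character_space \<subseteq> ?F"
        then obtain \<phi> where \<phi>: "\<phi> \<in> character_space - ?F" by blast
        then obtain a where a: "\<And>\<psi>. \<psi> \<in> ?F \<Longrightarrow> gelfand_transform a \<psi> = 0"
          "gelfand_transform a \<phi> \<noteq> 0"
          using assms(2) closedin_closure_of unfolding regular_algebra_def by metis
        have "\<mu> (int_iterate UNIV \<sigma> k a) = 0" for k
        proof -
          have "\<mu> \<circ> int_iterate UNIV \<sigma> k \<in> ?orb \<mu>" by (simp add: orb[OF \<mu>])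
          then have "gelfand_transform a (\<mu> \<circ> int_iterate UNIV \<sigma> k) = 0"
            using a(1) orbF by blast
          then show ?thesis
            by (simp add: gelfand_transform_def character_iterate[OF \<mu>])
        qed
        then have "a = 0" using van \<mu> by blast
        then show False
          using a(2) \<phi> by (simp add: gelfand_transform_def character_zero)
      qed
      then show "?F = character_space"
        using closure_of_subset_topspace[of gelfand_topology "?orb \<mu>"]
        by (simp add: topspace_gelfand_topology)
    qed
  qed
qed

text \<open>
  A periodic point has a finite orbit. A finite set of characters can be separated from any
  further character by a product of elements \<open>x - \<phi>(x)1\<close>, so a finite orbit is not dense in an
  infinite space.
\<close>

lemma no_periodic_character:
  assumes van: "\<And>\<mu> b. \<mu> \<in> character_space \<Longrightarrow> (\<And>k. \<mu> (int_iterate UNIV \<sigma> k b) = 0) \<Longrightarrow> b = 0"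
    and inf: "infinite (character_space :: ('a \<Rightarrow> complex) set)"
    and \<mu>: "\<mu> \<in> character_space" and "n \<noteq> 0"
  shows "\<exists>a. \<mu> (int_iterate UNIV \<sigma> n a) \<noteq> \<mu> a"
proof (rule ccontr)
  assume "\<not> ?thesis"
  \<comment> \<open>A period may be taken positive, and all its multiples are periods, so every orbit point
    is reached by an exponent in \<open>{0..<\<bar>n\<bar>}\<close>.\<close>
  then have per0: "\<mu> (int_iterate UNIV \<sigma> n a) = \<mu> a" for a by simp
  have per: "\<mu> (int_iterate UNIV \<sigma> \<bar>n\<bar> a) = \<mu> a" for a
  proof (cases "n \<ge> 0")
    case False
    then show ?thesis
      using per0[of "int_iterate UNIV \<sigma> (- n) a"]
        int_iterate_minus_cancel[OF automorphism_bij, of n a] by simp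
  qed (simp add: per0)
  have per': "\<mu> (int_iterate UNIV \<sigma> (\<bar>n\<bar> * q) a) = \<mu> a" for q a
  proof (induction q rule: int_induct[where k = 0])
    case (step1 i)
    have "int_iterate UNIV \<sigma> (\<bar>n\<bar> * (i + 1)) a
        = int_iterate UNIV \<sigma> \<bar>n\<bar> (int_iterate UNIV \<sigma> (\<bar>n\<bar> * i) a)"
      by (simp add: int_iterate_add[OF automorphism_bij, symmetric] algebra_simps)
    then show ?case using step1 per by simp
  next
    case (step2 i)
    have "int_iterate UNIV \<sigma> (\<bar>n\<bar> * i) a
        = int_iterate UNIV \<sigma> \<bar>n\<bar> (int_iterate UNIV \<sigma> (\<bar>n\<bar> * (i - 1)) a)"
      by (simp add: int_iterate_add[OF automorphism_bij, symmetric] algebra_simps)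
    then show ?case using step2 per by simp
  qed simp
  define Orb where "Orb = (\<lambda>k. \<mu> \<circ> int_iterate UNIV \<sigma> k) ` {0..<\<bar>n\<bar>}"
  have fin: "finite Orb" by (simp add: Orb_def)
  have char: "\<phi> \<in> character_space" if "\<phi> \<in> Orb" for \<phi>
    using that character_iterate[OF \<mu>] by (auto simp: Orb_def)
  have in_Orb: "\<mu> \<circ> int_iterate UNIV \<sigma> k \<in> Orb" for k
  proof -
    have "\<mu> \<circ> int_iterate UNIV \<sigma> k = \<mu> \<circ> int_iterate UNIV \<sigma> (k mod \<bar>n\<bar>)"
    proof
      fix a
      have "int_iterate UNIV \<sigma> k a
          = int_iterate UNIV \<sigma> (\<bar>n\<bar> * (k div \<bar>n\<bar>)) (int_iterate UNIV \<sigma> (k mod \<bar>n\<bar>) a)"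
        by (simp add: int_iterate_add[OF automorphism_bij, symmetric])
      then show "(\<mu> \<circ> int_iterate UNIV \<sigma> k) a = (\<mu> \<circ> int_iterate UNIV \<sigma> (k mod \<bar>n\<bar>)) a"
        using per' by simp
    qed
    then show ?thesis using \<open>n \<noteq> 0\<close> by (auto simp: Orb_def)
  qed
  obtain \<psi> where \<psi>: "\<psi> \<in> character_space" "\<psi> \<notin> Orb"
    using inf fin by (meson finite_subset subsetI)
  have "\<exists>b. (\<forall>\<phi>\<in>S. \<phi> b = 0) \<and> \<psi> b \<noteq> 0" if "finite S" "S \<subseteq> Orb" for S
    using that
  proof (induction S)
    case empty
    show ?case by (rule exI[of _ 1]) (simp add: character_one[OF \<psi>(1)])
  next
    case (insert \<phi> S)
    then obtain b where b: "\<forall>\<phi>\<in>S. \<phi> b = 0" "\<psi> b \<noteq> 0" by auto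
    have "\<phi> \<noteq> \<psi>" using insert \<psi> by auto
    then obtain x where x: "\<phi> x \<noteq> \<psi> x" by (auto simp: fun_eq_iff)
    have \<phi>: "\<phi> \<in> character_space" using insert char by auto
    let ?c = "(x - \<phi> x *\<^sub>C 1) * b"
    have "\<phi>' ?c = 0" if "\<phi>' \<in> insert \<phi> S" for \<phi>'
    proof -
      have "\<phi>' \<in> character_space" using that insert.prems char by auto
      from characterD[OF this] that b(1) show ?thesis by auto
    qed
    moreover have "\<psi> ?c \<noteq> 0"
      using characterD[OF \<psi>(1)] x b(2) by simp
    ultimately show ?case by blast
  qed
  from this[OF fin] obtain b where b: "\<And>\<phi>. \<phi> \<in> Orb \<Longrightarrow> \<phi> b = 0" "\<psi> b \<noteq> 0" by auto
  have "b = 0"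
    by (rule van[OF \<mu>]) (use b(1)[OF in_Orb] in simp)
  then show False using b(2) character_zero[OF \<psi>(1)] by simp
qed

end

section \<open>Submultiplicative seminorms have non-empty spectra\<close>

lemma sum_powers_of_roots_of_unity:
  assumes "0 < m" "m \<le> n"
  shows "(\<Sum>k<n. cis (2 * pi * real k / real n) ^ m) = (if m = n then of_nat n else 0)"
proof -
  define w where "w = cis (2 * pi * real m / real n)"
  have n: "n > 0" using assms by simp
  have "(\<Sum>k<n. cis (2 * pi * real k / real n) ^ m) = (\<Sum>k<n. w ^ k)"
    by (simp add: w_def Complex.DeMoivre algebra_simps)
  also have "\<dots> = (if m = n then of_nat n else 0)"
  proof (cases "m = n")
    case True
    then have "w = 1" using n by (simp add: w_def complex_eq_iff)
    then show ?thesis using True by simp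
  next
    case False
    have inj: "inj_on (\<lambda>k. cis (2 * pi * real k / real n)) {..<n}"
      using Complex.bij_betw_roots_unity[OF n] by (simp add: bij_betw_def)
    have "w \<noteq> 1"
    proof
      assume "w = 1"
      then have "m = 0"
        using inj_onD[OF inj, of m 0] False assms n by (simp add: w_def)
      with assms show False by simp
    qed
    moreover have "w ^ n = 1"
    proof -
      have "w ^ n = cis (2 * pi * real m)" using n by (simp add: w_def Complex.DeMoivre)
      also have "\<dots> = 1" using cis_multiple_2pi[of "real m"] by simp
      finally show ?thesis .
    qed
    ultimately show ?thesis using False by (simp add: geometric_sum)
  qed
  finally show ?thesis .
qed

text \<open>
  The elements with \<open>q x = 0\<close> form an ideal. Such a \<open>q\<close> is a norm on the quotient by it, and
  \<open>q (x - y) = 0\<close> is equality in the quotient.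
\<close>

locale algebra_seminorm =
  fixes q :: "'a::complex_comm_banach_algebra \<Rightarrow> real"
  assumes triangle: "q (x + y) \<le> q x + q y"
    and scale: "q (c *\<^sub>C x) = cmod c * q x"
    and submult: "q (x * y) \<le> q x * q y"
    and one_pos: "0 < q 1"
begin

lemma zero [simp]: "q 0 = 0"
  using scale[of 0 0] scaleC_of_real[of 0 "0::'a"] by simp

lemma minus [simp]: "q (- x) = q x"
  using scale[of "- 1" x] scaleC_of_real[of "- 1" x] by simp

lemma nonneg [simp]: "0 \<le> q x"
  using triangle[of x "- x"] by simp

lemma diff_commute: "q (x - y) = q (y - x)"
  using minus[of "x - y"] by simp

lemma triangle_diff: "q (x - y) \<le> q x + q y"
  using triangle[of x "- y"] by simp

lemma diff_triangle: "q (x - z) \<le> q (x - y) + q (y - z)"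
  using triangle[of "x - y" "y - z"] by simp

lemma reverse_triangle: "\<bar>q x - q y\<bar> \<le> q (x - y)"
  using triangle[of "x - y" y] triangle[of "y - x" x] diff_commute[of x y] by simp

lemma triangle_sum: "q (sum f S) \<le> (\<Sum>i\<in>S. q (f i))"
proof (induction S rule: infinite_finite_induct)
  case (insert x F)
  then show ?case using triangle[of "f x" "sum f F"] by simp
qed simp_all

lemma one_ge_1: "1 \<le> q 1"
  using submult[of 1 1] one_pos by simp

lemma null_mult: "q x = 0 \<Longrightarrow> q (x * y) = 0"
  using submult[of x y] nonneg[of "x * y"] by simp

lemma null_eq: "q (x - y) = 0 \<Longrightarrow> q x = q y"
  using reverse_triangle[of x y] by simp

lemma power_le: "q (x ^ n) \<le> q 1 * q x ^ n"
proof (induction n)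
  case (Suc n)
  have "q (x ^ Suc n) \<le> q x * q (x ^ n)" using submult[of x "x ^ n"] by simp
  also have "\<dots> \<le> q x * (q 1 * q x ^ n)" by (rule mult_left_mono[OF Suc]) simp
  finally show ?case by (simp add: algebra_simps)
qed simp

text \<open>
  The next two lemmas treat \<open>F\<close> as the inverse of \<open>1 - u\<close> modulo \<open>q\<close>: if \<open>u\<close> is small then \<open>F\<close> is
  close to \<open>1\<close>, because \<open>F - 1 = F * u\<close>; and if \<open>F\<close> is close to \<open>1\<close> then \<open>u\<close> is at least bounded,
  because \<open>1 - u = 1 - (F - 1) * (1 - u)\<close>.
\<close>

lemma near_one_of_small:
  assumes inv: "q (F * (1 - u) - 1) = 0" and u: "q u \<le> 1 / 2"
  shows "q (F - 1) \<le> 2 * q 1 * q u"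
proof -
  have "(F - 1) - F * u = F * (1 - u) - 1" by (simp add: algebra_simps)
  then have e: "q (F - 1) = q (F * u)" using inv by (intro null_eq) (simp only:)
  also have "\<dots> \<le> q F * q u" by (rule submult)
  finally have 1: "q (F - 1) \<le> q F * q u" .
  have "q F \<le> q 1 + q (F - 1)" using triangle[of 1 "F - 1"] by simp
  also have "\<dots> \<le> q 1 + q F * (1 / 2)"
    using 1 mult_left_mono[OF u, of "q F"] by simp
  finally have "q F \<le> 2 * q 1" by simp
  then have "q F * q u \<le> 2 * q 1 * q u" by (rule mult_right_mono) simp
  with 1 show ?thesis by simp
qed

lemma bounded_of_near_one:
  assumes inv: "q (F * (1 - u) - 1) = 0" and F: "q (F - 1) \<le> 1 / 2"
  shows "q u \<le> 3 * q 1"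
proof -
  have "(1 - u) - (1 - (F - 1) * (1 - u)) = F * (1 - u) - 1" by (simp add: algebra_simps)
  then have "q (1 - u) = q (1 - (F - 1) * (1 - u))" using inv by (intro null_eq) (simp only:)
  also have "\<dots> \<le> q 1 + q (F - 1) * q (1 - u)"
    using triangle_diff[of 1 "(F - 1) * (1 - u)"] submult[of "F - 1" "1 - u"] by simp
  also have "\<dots> \<le> q 1 + (1 / 2) * q (1 - u)"
    using mult_right_mono[OF F, of "q (1 - u)"] by simp
  finally have "q (1 - u) \<le> 2 * q 1" by simp
  then show ?thesis using triangle_diff[of 1 "1 - u"] by simp
qed

text \<open>
  For a contradiction, suppose that \<open>a\<close> has empty spectrum, so that there is a resolvent \<open>b\<close> defined
  on the whole plane.
\<close>

context
  fixes a :: 'a and b :: "complex \<Rightarrow> 'a"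
  assumes b: "q (b \<zeta> * (a - \<zeta> *\<^sub>C 1) - 1) = 0"
begin

text \<open>The resolvent identity \<open>b \<zeta> - b \<mu> = (\<zeta> - \<mu>) b \<zeta> b \<mu>\<close>, which holds modulo \<open>q\<close>.\<close>

lemma resolvent_diff_le: "q (b \<zeta> - b \<mu>) \<le> cmod (\<zeta> - \<mu>) * (q (b \<zeta>) * q (b \<mu>))"
proof -
  have "(b \<zeta> - b \<mu>) - (\<zeta> - \<mu>) *\<^sub>C (b \<zeta> * b \<mu>)
     = b \<mu> * (b \<zeta> * (a - \<zeta> *\<^sub>C 1) - 1) - b \<zeta> * (b \<mu> * (a - \<mu> *\<^sub>C 1) - 1)"
    by (subst scaleC_conv_mult) (simp add: scaleC_diff_left algebra_simps)
  moreover have "q (b \<mu> * (b \<zeta> * (a - \<zeta> *\<^sub>C 1) - 1)) = 0" "q (b \<zeta> * (b \<mu> * (a - \<mu> *\<^sub>C 1) - 1)) = 0"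
    using null_mult[OF b] by (simp_all only: mult.commute[of "b _" "_ - 1"])
  ultimately have "q ((b \<zeta> - b \<mu>) - (\<zeta> - \<mu>) *\<^sub>C (b \<zeta> * b \<mu>)) = 0"
    by (smt (verit) triangle_diff nonneg)
  then have "q (b \<zeta> - b \<mu>) = cmod (\<zeta> - \<mu>) * q (b \<zeta> * b \<mu>)"
    by (simp add: null_eq flip: scale)
  then show ?thesis
    using mult_left_mono[OF submult, of "cmod (\<zeta> - \<mu>)" "b \<zeta>" "b \<mu>"] by simp
qed

lemma continuous_resolvent_seminorm: "continuous_on UNIV (\<lambda>\<zeta>. q (b \<zeta>))"
proof -
  have "((\<lambda>\<mu>. q (b \<mu>)) \<longlongrightarrow> q (b \<zeta>)) (at \<zeta>)" for \<zeta>
  proof -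
    let ?B = "q (b \<zeta>)"
    have "((\<lambda>\<mu>. cmod (\<zeta> - \<mu>) * ?B) \<longlongrightarrow> cmod (\<zeta> - \<zeta>) * ?B) (at \<zeta>)"
      by (intro tendsto_intros)
    then have small: "eventually (\<lambda>\<mu>. cmod (\<zeta> - \<mu>) * ?B < 1 / 2) (at \<zeta>)"
      by (rule order_tendstoD) simp
    have bound: "norm (q (b \<mu>) - ?B) \<le> cmod (\<zeta> - \<mu>) * (2 * ?B\<^sup>2)"
      if s: "cmod (\<zeta> - \<mu>) * ?B < 1 / 2" for \<mu>
    proof -
      have d: "\<bar>q (b \<mu>) - ?B\<bar> \<le> cmod (\<zeta> - \<mu>) * (?B * q (b \<mu>))"
        using reverse_triangle[of "b \<zeta>" "b \<mu>"] resolvent_diff_le[of \<zeta> \<mu>] by linarith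
      have "cmod (\<zeta> - \<mu>) * ?B * q (b \<mu>) \<le> 1 / 2 * q (b \<mu>)"
        by (rule mult_right_mono) (use s in simp_all)
      with d have "q (b \<mu>) \<le> 2 * ?B" by (simp add: mult.assoc)
      then have "cmod (\<zeta> - \<mu>) * (?B * q (b \<mu>)) \<le> cmod (\<zeta> - \<mu>) * (?B * (2 * ?B))"
        by (intro mult_left_mono) simp_all
      with d show ?thesis by (simp add: power2_eq_square algebra_simps)
    qed
    have "((\<lambda>\<mu>. cmod (\<zeta> - \<mu>) * (2 * ?B\<^sup>2)) \<longlongrightarrow> cmod (\<zeta> - \<zeta>) * (2 * ?B\<^sup>2)) (at \<zeta>)"
      by (intro tendsto_intros)
    then have "((\<lambda>\<mu>. q (b \<mu>) - ?B) \<longlongrightarrow> 0) (at \<zeta>)"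
      by (intro Lim_null_comparison[OF eventually_mono[OF small bound]]) simp_all
    then show ?thesis by (simp add: Lim_null[symmetric])
  qed
  then show ?thesis by (simp add: continuous_on_def)
qed

text \<open>
  Modulo \<open>q\<close>, \<open>b \<zeta>\<close> is \<open>1 / (a - \<zeta>)\<close>, so that \<open>- \<zeta> b \<zeta>\<close> is \<open>1 / (1 - a / \<zeta>)\<close>. This is the mean of
  \<open>1 / (1 - a / \<zeta>)\<close> over the \<open>n\<close> equidistant points \<open>\<zeta>\<close> of the circle of radius \<open>r\<close>. By partial
  fractions it is \<open>1 / (1 - (a / r)\<^sup>n)\<close>, see \<open>circle_mean_inverse\<close>.
\<close>

definition circle_mean :: "nat \<Rightarrow> real \<Rightarrow> 'a" where
  "circle_mean n r = ((- 1 / of_nat n) *\<^sub>C 1) *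
     (\<Sum>k<n. (of_real r * cis (2 * pi * real k / real n)) *\<^sub>C b (of_real r * cis (2 * pi * real k / real n)))"

lemma circle_mean_0: "circle_mean n 0 = 0"
  by (simp add: circle_mean_def)

text \<open>
  On a bounded disc the resolvent is bounded, by compactness, and then Lipschitz by the resolvent
  identity. The point is that the constant for the means does not depend on \<open>n\<close>.
\<close>

lemma circle_mean_lipschitz:
  "\<exists>L>0. \<forall>n>0. \<forall>r\<in>{0..R}. \<forall>s\<in>{0..R}. q (circle_mean n r - circle_mean n s) \<le> L * \<bar>r - s\<bar>"
proof -
  have "compact ((\<lambda>\<zeta>. q (b \<zeta>)) ` cball 0 R)"
    by (intro compact_continuous_image continuous_on_subset[OF continuous_resolvent_seminorm])
       auto
  from compact_imp_bounded[OF this]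
  obtain C where "\<forall>x \<in> (\<lambda>\<zeta>. q (b \<zeta>)) ` cball 0 R. norm x \<le> C"
    unfolding bounded_iff ..
  then have C: "q (b \<zeta>) \<le> C" if "cmod \<zeta> \<le> R" for \<zeta>
    using that by (simp add: dist_norm)
  define L where "L = \<bar>R\<bar> * (C * C) + \<bar>C\<bar> + 1"
  have L: "L > 0" unfolding L_def by (intro add_nonneg_pos) auto
  have G: "q (\<zeta> *\<^sub>C b \<zeta> - \<mu> *\<^sub>C b \<mu>) \<le> L * cmod (\<zeta> - \<mu>)" if "cmod \<zeta> \<le> R" "cmod \<mu> \<le> R" for \<zeta> \<mu>
  proof -
    have C0: "0 \<le> C" using C[OF that(1)] nonneg[of "b \<zeta>"] by linarith
    have "\<zeta> *\<^sub>C b \<zeta> - \<mu> *\<^sub>C b \<mu> = \<zeta> *\<^sub>C (b \<zeta> - b \<mu>) + (\<zeta> - \<mu>) *\<^sub>C b \<mu>"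
      by (subst (1 2 3 4) scaleC_conv_mult) (simp add: scaleC_diff_left algebra_simps)
    then have "q (\<zeta> *\<^sub>C b \<zeta> - \<mu> *\<^sub>C b \<mu>) \<le> cmod \<zeta> * q (b \<zeta> - b \<mu>) + cmod (\<zeta> - \<mu>) * q (b \<mu>)"
      using triangle[of "\<zeta> *\<^sub>C (b \<zeta> - b \<mu>)" "(\<zeta> - \<mu>) *\<^sub>C b \<mu>"] by (simp add: scale)
    also have "\<dots> \<le> \<bar>R\<bar> * (cmod (\<zeta> - \<mu>) * (C * C)) + cmod (\<zeta> - \<mu>) * C"
    proof (intro add_mono mult_mono)
      show "q (b \<zeta> - b \<mu>) \<le> cmod (\<zeta> - \<mu>) * (C * C)"
        by (rule order_trans[OF resolvent_diff_le])
           (intro mult_mono mult_nonneg_nonneg C that; simp add: C0)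
    qed (use that C C0 in auto)
    also have "\<dots> \<le> L * cmod (\<zeta> - \<mu>)"
      using C0 by (simp add: L_def algebra_simps)
    finally show ?thesis .
  qed
  have "q (circle_mean n r - circle_mean n s) \<le> L * \<bar>r - s\<bar>"
    if n: "n > 0" and rs: "r \<in> {0..R}" "s \<in> {0..R}" for n r s
  proof -
    let ?z = "\<lambda>t k. of_real t * cis (2 * pi * real k / real n)"
    have summand: "q (?z r k *\<^sub>C b (?z r k) - ?z s k *\<^sub>C b (?z s k)) \<le> L * \<bar>r - s\<bar>" for k
    proof -
      have "cmod (?z r k - ?z s k) = \<bar>r - s\<bar>"
        by (simp add: norm_mult flip: left_diff_distrib of_real_diff)
      then show ?thesis using G[of "?z r k" "?z s k"] rs by (simp add: norm_mult)
    qed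
    have "circle_mean n r - circle_mean n s
        = (- 1 / of_nat n) *\<^sub>C (\<Sum>k<n. ?z r k *\<^sub>C b (?z r k) - ?z s k *\<^sub>C b (?z s k))"
      unfolding circle_mean_def sum_subtractf right_diff_distrib[symmetric]
      by (rule scaleC_conv_mult[symmetric])
    then have "q (circle_mean n r - circle_mean n s)
        \<le> 1 / real n * (\<Sum>k<n. q (?z r k *\<^sub>C b (?z r k) - ?z s k *\<^sub>C b (?z s k)))"
      by (simp add: scale norm_divide divide_right_mono triangle_sum)
    also have "\<dots> \<le> 1 / real n * (\<Sum>k<n. L * \<bar>r - s\<bar>)"
      by (intro mult_left_mono sum_mono summand) simp
    finally show ?thesis using n by simp
  qed
  with L show ?thesis by blast
qed

text \<open>
  At each of the points \<open>\<zeta>\<close> the equation \<open>\<zeta>\<^sup>n = r\<^sup>n\<close> holds, so \<open>a - \<zeta>\<close> divides \<open>a\<^sup>n - r\<^sup>n\<close> and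
  \<open>\<zeta> b \<zeta> (a\<^sup>n - r\<^sup>n)\<close> is the polynomial \<open>\<Sum>i<n. \<zeta>\<^sup>n\<^sup>-\<^sup>i a\<^sup>i\<close> in \<open>a\<close>. Summed over the points, only its
  term \<open>i = 0\<close> survives.
\<close>

lemma circle_mean_inverse:
  assumes "n > 0" "r > 0"
  shows "q (circle_mean n r * (1 - (of_real (inverse r ^ n)) *\<^sub>C a ^ n) - 1) = 0"
proof -
  let ?e = "\<lambda>c. c *\<^sub>C (1::'a)"
  define z where "z k = of_real r * cis (2 * pi * real k / real n)" for k
  define P where "P \<zeta> = (\<Sum>i<n. ?e (\<zeta> ^ (n - i)) * a ^ i)" for \<zeta>
  have zn: "z k ^ n = of_real (r ^ n)" for k
  proof -
    have "cis (2 * pi * real k / real n) ^ n = 1"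
      using assms cis_multiple_2pi[of "real k"] by (simp add: Complex.DeMoivre)
    then show ?thesis by (simp add: z_def power_mult_distrib)
  qed
  have fac: "?e \<zeta> * (a ^ n - ?e (\<zeta> ^ n)) = (a - ?e \<zeta>) * P \<zeta>" for \<zeta>
  proof -
    have "a ^ n - ?e (\<zeta> ^ n) = (a - ?e \<zeta>) * (\<Sum>i<n. ?e \<zeta> ^ (n - Suc i) * a ^ i)"
      by (simp add: power_diff_sumr2 flip: scaleC_1_power)
    moreover have "?e \<zeta> * (\<Sum>i<n. ?e \<zeta> ^ (n - Suc i) * a ^ i) = P \<zeta>"
      unfolding P_def sum_distrib_left
    proof (rule sum.cong[OF refl])
      fix i assume "i \<in> {..<n}"
      then have "n - i = Suc (n - Suc i)" by simp
      then have "?e \<zeta> * ?e \<zeta> ^ (n - Suc i) = ?e (\<zeta> ^ (n - i))"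
        by (simp add: scaleC_1_power scaleC_1_mult)
      then show "?e \<zeta> * (?e \<zeta> ^ (n - Suc i) * a ^ i) = ?e (\<zeta> ^ (n - i)) * a ^ i"
        by (simp add: mult.assoc[symmetric])
    qed
    ultimately show ?thesis by (simp only: mult.left_commute[of "?e \<zeta>" "a - ?e \<zeta>"])
  qed
  have summand: "q (z k *\<^sub>C b (z k) * (a ^ n - ?e (of_real (r ^ n))) - P (z k)) = 0" for k
  proof -
    have "z k *\<^sub>C b (z k) * (a ^ n - ?e (of_real (r ^ n)))
        = b (z k) * (?e (z k) * (a ^ n - ?e (z k ^ n)))"
      unfolding zn by (subst scaleC_conv_mult) (simp add: mult_ac)
    also have "\<dots> = b (z k) * (a - ?e (z k)) * P (z k)"
      by (simp only: fac mult.assoc)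
    finally have "z k *\<^sub>C b (z k) * (a ^ n - ?e (of_real (r ^ n))) - P (z k)
        = (b (z k) * (a - ?e (z k)) - 1) * P (z k)"
      by (simp add: left_diff_distrib)
    then show ?thesis using null_mult[OF b] by simp
  qed
  have sumP: "(\<Sum>k<n. P (z k)) = ?e (of_nat n * of_real (r ^ n))"
  proof -
    have pow: "(\<Sum>k<n. z k ^ (n - i)) = (if i = 0 then of_nat n * of_real (r ^ n) else 0)"
      if "i < n" for i
      using sum_powers_of_roots_of_unity[of "n - i" n] that
      by (auto simp: z_def power_mult_distrib simp flip: sum_distrib_left)
    have "(\<Sum>k<n. P (z k)) = (\<Sum>i<n. \<Sum>k<n. ?e (z k ^ (n - i)) * a ^ i)"
      unfolding P_def by (rule sum.swap)
    also have "\<dots> = (\<Sum>i<n. ?e (\<Sum>k<n. z k ^ (n - i)) * a ^ i)"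
      by (simp add: scaleC_sum_left sum_distrib_right)
    also have "\<dots> = (\<Sum>i<n. if i = 0 then ?e (of_nat n * of_real (r ^ n)) else 0)"
      by (rule sum.cong) (auto simp: pow)
    also have "\<dots> = ?e (of_nat n * of_real (r ^ n))" using assms by simp
    finally show ?thesis .
  qed
  define S where "S = (\<Sum>k<n. z k *\<^sub>C b (z k))"
  have "q (\<Sum>k<n. z k *\<^sub>C b (z k) * (a ^ n - ?e (of_real (r ^ n))) - P (z k)) \<le> 0"
    by (rule order_trans[OF triangle_sum]) (simp only: summand sum.neutral_const order_refl)
  then have null: "q (S * (a ^ n - ?e (of_real (r ^ n))) - ?e (of_nat n * of_real (r ^ n))) = 0"
    using nonneg by (simp add: S_def sum_subtractf sumP sum_distrib_right order_antisym)
  define c :: complex where "c = (1 / of_nat n) * of_real (inverse r ^ n)"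
  have c1: "c * (of_nat n * of_real (r ^ n)) = 1" 
    using assms by (simp add: c_def field_simps)
  have c2: "c * of_real (r ^ n) = 1 / of_nat n"
    using assms by (simp add: c_def field_simps)
  have c3: "(1 / of_nat n) * of_real (inverse r ^ n) = c" by (simp add: c_def)
  have ring: "- (X * Y) * (1 - Z * W) - 1 = Y * ((X * Z) * W - X) - 1" for X Y Z W :: 'a
    by (simp add: algebra_simps)
  have "circle_mean n r = - (?e (1 / of_nat n) * S)"
    by (simp add: circle_mean_def S_def z_def scaleC_minus_left)
  then have "circle_mean n r * (1 - (of_real (inverse r ^ n)) *\<^sub>C a ^ n) - 1
      = - (?e (1 / of_nat n) * S) * (1 - ?e (of_real (inverse r ^ n)) * a ^ n) - 1"
    by (subst scaleC_conv_mult[of _ "a ^ n"]) (simp only:)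
  also have "\<dots> = S * ((?e (1 / of_nat n) * ?e (of_real (inverse r ^ n))) * a ^ n - ?e (1 / of_nat n)) - 1"
    by (simp only: ring)
  also have "\<dots> = S * (?e c * a ^ n - ?e (c * of_real (r ^ n))) - ?e (c * (of_nat n * of_real (r ^ n)))"
    by (simp only: scaleC_1_mult c1 c2 c3 scaleC_one)
  also have "\<dots> = ?e c * (S * (a ^ n - ?e (of_real (r ^ n))) - ?e (of_nat n * of_real (r ^ n)))"
    by (simp only: scaleC_1_mult[symmetric] right_diff_distrib mult_ac)
  finally show ?thesis
    using null_mult[OF null] by (simp add: mult.commute)
qed

end

text \<open>
  Suppose that there is a resolvent on the whole plane, and let \<open>E\<close> be the set of radii \<open>r\<close> with \<open>(a / r)\<^sup>n \<longlonglongrightarrow> 0\<close>, equivalently with circle means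
  tending to \<open>1\<close>. It contains all large radii. The uniform Lipschitz bound lets one pass from a
  radius of \<open>E\<close> to one smaller by a fixed amount \<open>\<delta>\<close>, at which the means are still within \<open>1 / 2\<close>
  of \<open>1\<close>, so that \<open>(a / s)\<^sup>n\<close> is still bounded and every radius above \<open>s\<close> is in \<open>E\<close>. Starting close
  to \<open>Inf E\<close> this gives a radius of \<open>E\<close> below \<open>Inf E\<close>, or reaches the radius \<open>0\<close>, where all the means
  are \<open>0\<close>.
\<close>

theorem spectrum_nonempty: "\<exists>\<zeta>. \<forall>x. q (x * (a - \<zeta> *\<^sub>C 1) - 1) \<noteq> 0"
proof (rule ccontr)
  assume "\<not> ?thesis"
  then obtain b where b: "\<And>\<zeta>. q (b \<zeta> * (a - \<zeta> *\<^sub>C 1) - 1) = 0" by metis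
  define E where "E = {r. r > 0 \<and> (\<lambda>n. q (a ^ n) / r ^ n) \<longlonglongrightarrow> 0}"
  let ?F = "circle_mean b"
  define u where "u r n = of_real (inverse r ^ n) *\<^sub>C a ^ n" for r n
  have qu: "q (u r n) = q (a ^ n) / r ^ n" if "r > 0" for r n
    unfolding u_def scale norm_of_real using that
    by (simp add: divide_inverse power_inverse mult.commute)
  have Fu: "q (?F n r * (1 - u r n) - 1) = 0" if "n > 0" "r > 0" for n r
    unfolding u_def using circle_mean_inverse[OF b that] .
  have inE: "s' \<in> E" if "0 < s" "s < s'" and ev: "eventually (\<lambda>n. q (a ^ n) / s ^ n \<le> K) sequentially"
    for s s' K
  proof -
    have "eventually (\<lambda>n. norm (q (a ^ n) / s' ^ n) \<le> K * (s / s') ^ n) sequentially"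
      using ev
    proof eventually_elim
      case (elim n)
      have "q (a ^ n) / s' ^ n = q (a ^ n) / s ^ n * (s / s') ^ n"
        using that by (simp add: field_simps)
      also have "\<dots> \<le> K * (s / s') ^ n"
        using elim that by (intro mult_right_mono) auto
      finally show ?case using that by simp
    qed
    moreover have "(\<lambda>n. K * (s / s') ^ n) \<longlonglongrightarrow> 0"
      using that by (intro tendsto_mult_right_zero LIMSEQ_realpow_zero) auto
    ultimately have "(\<lambda>n. q (a ^ n) / s' ^ n) \<longlonglongrightarrow> 0"
      by (rule Lim_null_comparison)
    then show ?thesis using that by (simp add: E_def)
  qed
  have big: "q a + 2 \<in> E"
  proof (rule inE)
    show "eventually (\<lambda>n. q (a ^ n) / (q a + 1) ^ n \<le> q 1) sequentially"
    proof (rule always_eventually, rule allI)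
      fix n
      have "q (a ^ n) \<le> q 1 * (q a + 1) ^ n"
        by (rule order_trans[OF power_le]) (intro mult_left_mono power_mono; simp)
      moreover have "(q a + 1) ^ n > 0" using nonneg[of a] by (simp add: add_nonneg_pos)
      ultimately show "q (a ^ n) / (q a + 1) ^ n \<le> q 1" by (simp add: divide_le_eq)
    qed
  qed (simp_all add: add_nonneg_pos)
  obtain L where L: "L > 0" and lip:
    "\<And>n r s. n > 0 \<Longrightarrow> r \<in> {0..q a + 3} \<Longrightarrow> s \<in> {0..q a + 3} \<Longrightarrow> q (?F n r - ?F n s) \<le> L * \<bar>r - s\<bar>"
    using circle_mean_lipschitz[OF b, of "q a + 3"] by blast
  define \<delta> where "\<delta> = min 1 (1 / (4 * L))"
  have \<delta>: "0 < \<delta>" "\<delta> \<le> 1" "L * \<delta> \<le> 1 / 4"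
  proof -
    show "0 < \<delta>" "\<delta> \<le> 1" using L by (auto simp: \<delta>_def)
    have "L * \<delta> \<le> L * (1 / (4 * L))" using L by (intro mult_left_mono) (auto simp: \<delta>_def)
    then show "L * \<delta> \<le> 1 / 4" using L by simp
  qed
  have near: "eventually (\<lambda>n. n > 0 \<and> q (?F n s - 1) \<le> 1 / 2) sequentially"
    if r: "r \<in> E" "r \<le> q a + 3" and s: "0 \<le> s" "s \<le> q a + 3" "\<bar>s - r\<bar> \<le> \<delta>" for r s
  proof -
    have lim: "(\<lambda>n. q (a ^ n) / r ^ n) \<longlonglongrightarrow> 0" and r0: "r > 0" using r by (auto simp: E_def)
    have "0 < 1 / (8 * q 1)" using one_pos by simp
    from order_tendstoD(2)[OF lim this] show ?thesis
      using eventually_gt_at_top[of 0]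
    proof eventually_elim
      case (elim n)
      have small: "q (u r n) < 1 / (8 * q 1)" using elim r0 by (simp add: qu)
      also have "\<dots> \<le> 1 / 2" using one_ge_1 by (simp add: field_simps)
      finally have "q (?F n r - 1) \<le> 2 * q 1 * q (u r n)"
        by (intro near_one_of_small Fu elim r0) simp
      also have "\<dots> \<le> 1 / 4" using small one_pos by (simp add: field_simps)
      finally have "q (?F n r - 1) \<le> 1 / 4" .
      moreover have "q (?F n s - ?F n r) \<le> L * \<bar>s - r\<bar>"
        using r r0 s elim by (intro lip) auto
      moreover have "L * \<bar>s - r\<bar> \<le> L * \<delta>" using s L by (intro mult_left_mono) auto
      ultimately show ?case
        using diff_triangle[of "?F n s" 1 "?F n r"] \<delta> elim by simp
    qed
  qed
  define r0 where "r0 = Inf E"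
  have bdd: "bdd_below E" by (rule bdd_belowI[of _ 0]) (auto simp: E_def)
  have r0: "0 \<le> r0" unfolding r0_def using big by (intro cInf_greatest) (auto simp: E_def)
  have r0_le: "r0 \<le> q a + 2" unfolding r0_def using big bdd by (rule cInf_lower)
  obtain r where r: "r \<in> E" "r < r0 + \<delta> / 2"
    using cInf_lessD[of E "r0 + \<delta> / 2"] big \<delta> by (auto simp: r0_def)
  have rr0: "r0 \<le> r" unfolding r0_def using r(1) bdd by (rule cInf_lower)
  have rR: "r \<le> q a + 3" using r \<delta> r0_le by simp
  \<comment> \<open>At distance less than \<open>\<delta>\<close> from \<open>r\<close>, but already below \<open>Inf E\<close> unless it is cut off at \<open>0\<close>.\<close>
  define s where "s = max 0 (r0 - \<delta> / 4)"
  have s: "0 \<le> s" "s \<le> q a + 3" "\<bar>s - r\<bar> \<le> \<delta>"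
    using r rr0 r0 r0_le \<delta> rR by (auto simp: s_def max_def)
  note ev = near[OF r(1) rR s]
  show False
  proof (cases "s = 0")
    case True
    from eventually_happens[OF ev] obtain n where "q (?F n s - 1) \<le> 1 / 2" by auto
    then have "q 1 \<le> 1 / 2" by (simp add: True circle_mean_0[OF b])
    then show False using one_ge_1 by simp
  next
    case False
    then have s0: "0 < s" "s < r0" using s(1) \<delta> r0 by (auto simp: s_def max_def split: if_splits)
    have "eventually (\<lambda>n. q (a ^ n) / s ^ n \<le> 3 * q 1) sequentially"
      using ev
    proof eventually_elim
      case (elim n)
      then show ?case using bounded_of_near_one[OF Fu[of n s]] s0 by (simp add: qu)
    qed
    then have "(s + r0) / 2 \<in> E" by (rule inE[rotated 2]) (use s0 in auto)
    then have "r0 \<le> (s + r0) / 2" unfolding r0_def using bdd by (rule cInf_lower)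
    then show False using s0 by simp
  qed
qed

end

section \<open>Maximal ideals and characters\<close>

text \<open>
  Ideals of the coefficient algebra are sets in the ring class, while ideals of the crossed product
  are those of a ring record; hence two notions.
\<close>

definition proper_ideal :: "'a::comm_ring_1 set \<Rightarrow> bool" where
  "proper_ideal J \<longleftrightarrow> 0 \<in> J \<and> (\<forall>x\<in>J. \<forall>y\<in>J. x + y \<in> J) \<and> (\<forall>a. \<forall>x\<in>J. a * x \<in> J) \<and> 1 \<notin> J"

lemma proper_idealD:
  assumes "proper_ideal J"
  shows "0 \<in> J" "x \<in> J \<Longrightarrow> y \<in> J \<Longrightarrow> x + y \<in> J" "x \<in> J \<Longrightarrow> a * x \<in> J" "1 \<notin> J"
    and "x \<in> J \<Longrightarrow> y \<in> J \<Longrightarrow> x - y \<in> J"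
proof -
  show *: "0 \<in> J" "x \<in> J \<Longrightarrow> y \<in> J \<Longrightarrow> x + y \<in> J" "x \<in> J \<Longrightarrow> a * x \<in> J" "1 \<notin> J" for x y a
    using assms by (auto simp: proper_ideal_def)
  show "x - y \<in> J" if "x \<in> J" "y \<in> J"
    using *(2)[OF that(1) *(3)[OF that(2), of "- 1"]] by simp
qed

lemma exists_maximal_ideal:
  assumes "proper_ideal J"
  shows "\<exists>M. proper_ideal M \<and> J \<subseteq> M \<and> (\<forall>N. proper_ideal N \<and> M \<subseteq> N \<longrightarrow> N = M)"
proof -
  let ?A = "{N. proper_ideal N \<and> J \<subseteq> N}"
  have "\<exists>M\<in>?A. \<forall>N\<in>?A. M \<subseteq> N \<longrightarrow> N = M"
  proof (rule subset_Zorn_nonempty)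
    show "?A \<noteq> {}" using assms by auto
    fix \<C> assume "\<C> \<noteq> {}" and chain: "subset.chain ?A \<C>"
    then have mem: "\<And>N. N \<in> \<C> \<Longrightarrow> proper_ideal N \<and> J \<subseteq> N"
      and tot: "\<And>N N'. N \<in> \<C> \<Longrightarrow> N' \<in> \<C> \<Longrightarrow> N \<subseteq> N' \<or> N' \<subseteq> N"
      unfolding subset_chain_def by blast+
    have "proper_ideal (\<Union>\<C>)"
      unfolding proper_ideal_def
    proof (intro conjI ballI allI)
      show "0 \<in> \<Union>\<C>" using \<open>\<C> \<noteq> {}\<close> mem proper_idealD(1) by blast
      show "1 \<notin> \<Union>\<C>" using mem proper_idealD(4) by blast
      show "a * x \<in> \<Union>\<C>" if "x \<in> \<Union>\<C>" for a x using that mem proper_idealD(3) by blast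
      show "x + y \<in> \<Union>\<C>" if xy: "x \<in> \<Union>\<C>" "y \<in> \<Union>\<C>" for x y
      proof -
        obtain N N' where N: "N \<in> \<C>" "x \<in> N" "N' \<in> \<C>" "y \<in> N'" using xy by blast
        with tot obtain K where "K \<in> \<C>" "x \<in> K" "y \<in> K" by blast
        then show ?thesis using mem proper_idealD(2) by blast
      qed
    qed
    then show "\<Union>\<C> \<in> ?A" using \<open>\<C> \<noteq> {}\<close> mem by blast
  qed
  then obtain M where M: "proper_ideal M" "J \<subseteq> M" "\<forall>N\<in>?A. M \<subseteq> N \<longrightarrow> N = M"
    by blast
  have "N = M" if "proper_ideal N" "M \<subseteq> N" for N
    using M(3)[rule_format, of N] M(2) that by simp
  with M(1,2) show ?thesis by blast
qed

lemma maximal_ideal_inverse: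
  assumes M: "proper_ideal M" and max: "\<And>N. proper_ideal N \<Longrightarrow> M \<subseteq> N \<Longrightarrow> N = M" and x: "x \<notin> M"
  shows "\<exists>y. y * x - 1 \<in> M"
proof -
  let ?N = "{m + y * x | m y. m \<in> M}"
  note D = proper_idealD[OF M]
  have "M \<subseteq> ?N"
  proof
    fix m assume "m \<in> M"
    then show "m \<in> ?N" by (intro CollectI exI[of _ m] exI[of _ 0]) simp
  qed
  moreover have "x \<in> ?N"
    using D(1) by (intro CollectI exI[of _ 0] exI[of _ 1]) simp
  ultimately have "\<not> proper_ideal ?N" using max x by blast
  moreover have "0 \<in> ?N" using \<open>M \<subseteq> ?N\<close> D(1) by blast
  moreover have "s + t \<in> ?N" if st: "s \<in> ?N" "t \<in> ?N" for s t
  proof -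
    obtain m y where "m \<in> M" "s = m + y * x" using st(1) by blast
    moreover obtain m' y' where "m' \<in> M" "t = m' + y' * x" using st(2) by blast
    ultimately show ?thesis
      using D(2) by (intro CollectI exI[of _ "m + m'"] exI[of _ "y + y'"]) (simp add: algebra_simps)
  qed
  moreover have "a * s \<in> ?N" if s: "s \<in> ?N" for a s
  proof -
    obtain m y where "m \<in> M" "s = m + y * x" using s by blast
    then have "a * s = a * m + (a * y) * x" "a * m \<in> M"
      by (simp_all add: D(3) distrib_left mult.assoc)
    then show ?thesis by blast
  qed
  ultimately have "1 \<in> ?N" unfolding proper_ideal_def by blast
  then obtain m y where m: "m \<in> M" "1 = m + y * x" by blast
  then have "y * x - 1 = - 1 * m" by (simp add: algebra_simps)
  then show ?thesis using D(3)[OF m(1), of "- 1"] by metis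
qed

text \<open>
  The Neumann series. The factor \<open>norm 1\<close> in the bound for the powers is there because the norm of
  the unit may differ from \<open>1\<close>.
\<close>

lemma one_minus_invertible:
  fixes x :: "'a::complex_comm_banach_algebra"
  assumes "norm x < 1"
  shows "\<exists>y. y * (1 - x) = 1"
proof -
  have pow: "norm (x ^ n) \<le> norm (1::'a) * norm x ^ n" for n
  proof (induction n)
    case (Suc n)
    have "norm (x ^ Suc n) \<le> norm x * norm (x ^ n)" using norm_mult_ineq by simp
    also have "\<dots> \<le> norm x * (norm (1::'a) * norm x ^ n)" by (rule mult_left_mono[OF Suc]) simp
    finally show ?case by (simp add: algebra_simps)
  qed simp
  have "summable (\<lambda>n. norm (1::'a) * norm x ^ n)"
    using assms by (intro summable_mult summable_geometric) simp
  then have sm: "summable (\<lambda>n. x ^ n)"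
    by (rule summable_comparison_test'[of _ 0]) (rule pow)
  then have "(\<lambda>n. (\<Sum>k<n. x ^ k) * (1 - x)) \<longlonglongrightarrow> (\<Sum>k. x ^ k) * (1 - x)"
    by (intro tendsto_mult summable_LIMSEQ tendsto_const)
  moreover have "(\<Sum>k<n. x ^ k) * (1 - x) = 1 - x ^ n" for n
    by (simp add: one_diff_power_eq mult.commute)
  moreover have "(\<lambda>n. 1 - x ^ n) \<longlonglongrightarrow> 1 - 0"
    by (intro tendsto_diff tendsto_const summable_LIMSEQ_zero sm)
  ultimately have "(\<Sum>k. x ^ k) * (1 - x) = 1"
    using LIMSEQ_unique by fastforce
  then show ?thesis by blast
qed

text \<open>
  The quotient norm. It is non-zero at \<open>1\<close> because an element of \<open>M\<close> close to \<open>1\<close> would be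
  invertible; this is where completeness of the algebra enters.
\<close>

lemma algebra_seminorm_infdist:
  fixes M :: "'a::complex_comm_banach_algebra set"
  assumes M: "proper_ideal M"
  shows "algebra_seminorm (\<lambda>x. infdist x M)"
proof
  note D = proper_idealD[OF M]
  have less_iff: "infdist x M < t \<longleftrightarrow> (\<exists>m\<in>M. norm (x - m) < t)" for x t
  proof -
    have "M \<noteq> {}" "bdd_below (dist x ` M)" using D(1) by (auto intro: bdd_belowI[of _ 0])
    then show ?thesis by (simp add: infdist_notempty cINF_less_iff dist_norm)
  qed
  have le: "infdist x M \<le> norm (x - m)" if "m \<in> M" for x m
    using infdist_le[OF that, of x] by (simp add: dist_norm)
  have approx: "\<exists>m\<in>M. norm (x - m) < infdist x M + e" if "e > 0" for x e
    using that less_iff[of x "infdist x M + e"] by simp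
  show "infdist (x + y) M \<le> infdist x M + infdist y M" for x y
  proof (rule field_le_epsilon)
    fix e :: real assume "0 < e"
    then obtain m k where m: "m \<in> M" "norm (x - m) < infdist x M + e / 2"
      and k: "k \<in> M" "norm (y - k) < infdist y M + e / 2"
      using approx[of "e / 2"] by (meson half_gt_zero)
    have "infdist (x + y) M \<le> norm ((x + y) - (m + k))" using D(2) m k by (intro le) simp
    also have "\<dots> \<le> norm (x - m) + norm (y - k)" by (rule norm_diff_triangle_ineq)
    finally show "infdist (x + y) M \<le> infdist x M + infdist y M + e" using m k by simp
  qed
  have sc: "c *\<^sub>C m \<in> M" if "m \<in> M" for c m
    using D(3)[OF that] by (simp add: scaleC_conv_mult[of c m])
  have scale_le: "infdist (c *\<^sub>C x) M \<le> cmod c * infdist x M" for c x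
  proof (rule field_le_epsilon)
    fix e :: real assume e: "0 < e"
    define d where "d = e / (cmod c + 1)"
    have d: "d > 0" "cmod c * d \<le> e" using e by (auto simp: d_def field_simps add_pos_nonneg add_nonneg_pos)
    then obtain m where m: "m \<in> M" "norm (x - m) < infdist x M + d" using approx by blast
    have "c *\<^sub>C x - c *\<^sub>C m = c *\<^sub>C (x - m)"
      using scaleC_add_right[of c "x - m" m] by simp
    then have "infdist (c *\<^sub>C x) M \<le> cmod c * norm (x - m)"
      using le[OF sc[OF m(1)], of "c *\<^sub>C x" c] by (simp add: norm_scaleC)
    also have "\<dots> \<le> cmod c * (infdist x M + d)" using m by (intro mult_left_mono) auto
    finally show "infdist (c *\<^sub>C x) M \<le> cmod c * infdist x M + e"
      using d by (simp add: distrib_left)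
  qed
  show "infdist (c *\<^sub>C x) M = cmod c * infdist x M" for c x
  proof (cases "c = 0")
    case True
    then show ?thesis using D(1) by simp
  next
    case False
    have "infdist x M \<le> cmod (inverse c) * infdist (c *\<^sub>C x) M"
      using scale_le[of "inverse c" "c *\<^sub>C x"] False by (simp add: scaleC_scaleC)
    then have "cmod c * infdist x M \<le> cmod c * (cmod (inverse c) * infdist (c *\<^sub>C x) M)"
      by (rule mult_left_mono) simp
    also have "\<dots> = infdist (c *\<^sub>C x) M" using False by (simp add: norm_inverse)
    finally have "cmod c * infdist x M \<le> infdist (c *\<^sub>C x) M" .
    then show ?thesis using scale_le[of c x] by simp
  qed
  show "infdist (x * y) M \<le> infdist x M * infdist y M" for x y
  proof (rule LIMSEQ_le_const)
    have "(\<lambda>n. t + inverse (real (Suc n))) \<longlonglongrightarrow> t" for t :: real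
      using tendsto_add[OF tendsto_const LIMSEQ_inverse_real_of_nat, of t] by simp
    then show "(\<lambda>n. (infdist x M + inverse (real (Suc n))) * (infdist y M + inverse (real (Suc n))))
        \<longlonglongrightarrow> infdist x M * infdist y M"
      by (intro tendsto_mult)
    have "infdist (x * y) M \<le> (infdist x M + e) * (infdist y M + e)" if e: "e > 0" for e
    proof -
      obtain m k where m: "m \<in> M" "norm (x - m) < infdist x M + e"
        and k: "k \<in> M" "norm (y - k) < infdist y M + e"
        using approx[OF e] by meson
      have eq: "(x - m) * (y - k) = x * y - (y * m + (x - m) * k)" by (simp add: algebra_simps)
      have "y * m + (x - m) * k \<in> M" using D(2,3) m k by blast
      then have "infdist (x * y) M \<le> norm ((x - m) * (y - k))" unfolding eq by (rule le)
      also have "\<dots> \<le> norm (x - m) * norm (y - k)" by (rule norm_mult_ineq)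
      also have "\<dots> \<le> (infdist x M + e) * (infdist y M + e)"
        using m k by (intro mult_mono) (auto intro: add_nonneg_nonneg infdist_nonneg e[THEN less_imp_le])
      finally show ?thesis .
    qed
    then show "\<exists>N. \<forall>n\<ge>N. infdist (x * y) M \<le>
        (infdist x M + inverse (real (Suc n))) * (infdist y M + inverse (real (Suc n)))"
      by (meson inverse_positive_iff_positive of_nat_0_less_iff zero_less_Suc)
  qed
  show "0 < infdist 1 M"
  proof -
    have "1 \<le> infdist 1 M"
    proof (rule ccontr)
      assume "\<not> 1 \<le> infdist 1 M"
      then obtain m where m: "m \<in> M" "norm (1 - m) < 1" using less_iff[of 1 1] by auto
      then obtain y where "y * m = 1" using one_minus_invertible[of "1 - m"] by auto
      then show False using D(3)[OF m(1), of y] D(4) by simp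
    qed
    then show ?thesis by simp
  qed
qed

text \<open>
  Gelfand--Mazur: in the field obtained from a maximal ideal \<open>M\<close> above \<open>J\<close> every \<open>a\<close> has a spectral
  value \<open>\<lambda>\<close>, so \<open>a - \<lambda>1\<close> is not invertible modulo \<open>M\<close> and therefore lies in \<open>M\<close>. The character
  maps \<open>a\<close> to this \<open>\<lambda>\<close>, which is unique.
\<close>

theorem character_vanishing_on_proper_ideal:
  fixes J :: "'a::complex_comm_banach_algebra set"
  assumes "proper_ideal J"
  shows "\<exists>\<mu>\<in>character_space. \<forall>x\<in>J. \<mu> x = 0"
proof -
  from exists_maximal_ideal[OF assms] obtain M where M: "proper_ideal M" "J \<subseteq> M"
    and max0: "\<forall>N. proper_ideal N \<and> M \<subseteq> N \<longrightarrow> N = M"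
    by (elim exE conjE) (rule that)
  have max: "N = M" if "proper_ideal N" "M \<subseteq> N" for N
    using max0 that by simp
  note D = proper_idealD[OF M(1)]
  interpret algebra_seminorm "\<lambda>x. infdist x M" by (rule algebra_seminorm_infdist[OF M(1)])
  have "\<exists>c. a - c *\<^sub>C 1 \<in> M" for a
  proof -
    obtain c where c: "\<And>x. infdist (x * (a - c *\<^sub>C 1) - 1) M \<noteq> 0"
      using spectrum_nonempty[of a] by blast
    have "a - c *\<^sub>C 1 \<in> M"
    proof (rule ccontr)
      assume "a - c *\<^sub>C 1 \<notin> M"
      then obtain y where "y * (a - c *\<^sub>C 1) - 1 \<in> M"
        using maximal_ideal_inverse[OF M(1) max] by blast
      then show False using c[of y] by simp
    qed
    then show ?thesis ..
  qed
  then obtain \<mu> where \<mu>: "\<And>a. a - \<mu> a *\<^sub>C 1 \<in> M" by metis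
  have uniq: "\<mu> a = c" if "a - c *\<^sub>C 1 \<in> M" for a c
  proof (rule ccontr)
    assume ne: "\<mu> a \<noteq> c"
    have "(\<mu> a - c) *\<^sub>C 1 = (a - c *\<^sub>C 1) - (a - \<mu> a *\<^sub>C 1)"
      by (simp add: scaleC_diff_left)
    then have "(\<mu> a - c) *\<^sub>C 1 \<in> M" using D(5)[OF that \<mu>[of a]] by metis
    from D(3)[OF this, of "(1 / (\<mu> a - c)) *\<^sub>C 1"] have "1 \<in> M"
      using ne by (simp add: scaleC_1_mult)
    then show False using D(4) by simp
  qed
  have "\<mu> \<in> character_space"
    unfolding character_space_def
  proof (intro CollectI conjI allI)
    show "\<mu> (x + y) = \<mu> x + \<mu> y" for x y
      by (rule uniq) (use D(2)[OF \<mu>[of x] \<mu>[of y]] in \<open>simp add: scaleC_add_left algebra_simps\<close>)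
    show "\<mu> (x * y) = \<mu> x * \<mu> y" for x y
    proof (rule uniq)
      have "x * y - (\<mu> x * \<mu> y) *\<^sub>C 1 = y * (x - \<mu> x *\<^sub>C 1) + (\<mu> x *\<^sub>C 1) * (y - \<mu> y *\<^sub>C 1)"
        by (simp add: algebra_simps flip: scaleC_1_mult)
      then show "x * y - (\<mu> x * \<mu> y) *\<^sub>C 1 \<in> M"
        using D(2)[OF D(3)[OF \<mu>[of x]] D(3)[OF \<mu>[of y]]] by metis
    qed
    show "\<mu> (c *\<^sub>C x) = c * \<mu> x" for c x
    proof (rule uniq)
      have "c *\<^sub>C x - (c * \<mu> x) *\<^sub>C 1 = (c *\<^sub>C 1) * (x - \<mu> x *\<^sub>C 1)"
        by (subst scaleC_conv_mult) (simp add: algebra_simps flip: scaleC_1_mult)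
      then show "c *\<^sub>C x - (c * \<mu> x) *\<^sub>C 1 \<in> M"
        using D(3)[OF \<mu>[of x]] by metis
    qed
    have "\<mu> 1 = 1" by (rule uniq) (simp add: D(1))
    then show "\<exists>x. \<mu> x \<noteq> 0" by (intro exI[of _ 1]) simp
  qed
  moreover have "\<mu> x = 0" if "x \<in> J" for x
    by (rule uniq) (use that M(2) in auto)
  ultimately show ?thesis by blast
qed

section \<open>Ideals of the crossed product\<close>

lemma crossed_product_simps:
  "carrier (crossed_product \<sigma>) = {f. finite {n. f n \<noteq> 0}}"
  "f \<otimes>\<^bsub>crossed_product \<sigma>\<^esub> g = twisted_convolution \<sigma> f g"
  "f \<oplus>\<^bsub>crossed_product \<sigma>\<^esub> g = (\<lambda>n. f n + g n)"
  "\<zero>\<^bsub>crossed_product \<sigma>\<^esub> = (\<lambda>n. 0)"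
  "c \<odot>\<^bsub>crossed_product \<sigma>\<^esub> f = (\<lambda>n. c *\<^sub>C f n)"
  by (simp_all add: crossed_product_def)

definition single :: "int \<Rightarrow> 'a \<Rightarrow> int \<Rightarrow> 'a::zero" where
  "single m a = (\<lambda>n. if n = m then a else 0)"

lemma one_crossed_product: "\<one>\<^bsub>crossed_product \<sigma>\<^esub> = single 0 1"
  by (simp add: crossed_product_def single_def)

lemma finite_support_single: "finite {n. single m a n \<noteq> 0}"
  by (rule finite_subset[of _ "{m}"]) (auto simp: single_def)

lemma single_in_carrier: "single m a \<in> carrier (crossed_product \<sigma>)"
  by (simp add: crossed_product_simps finite_support_single)

context
  fixes \<sigma> :: "'a::complex_comm_banach_algebra \<Rightarrow> 'a"
  assumes \<sigma>: "algebra_automorphism \<sigma>"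
begin

lemma convolution_single_left:
  "twisted_convolution \<sigma> (single m a) g n = a * int_iterate UNIV \<sigma> m (g (n - m))"
  by (subst twisted_convolution_sum[of "{m}"]) (auto simp: single_def)

lemma convolution_single_right:
  assumes "finite {n. f n \<noteq> 0}"
  shows "twisted_convolution \<sigma> f (single m a) n = f (n - m) * int_iterate UNIV \<sigma> (n - m) a"
proof -
  let ?S = "insert (n - m) {k. f k \<noteq> 0}"
  have "twisted_convolution \<sigma> f (single m a) n
      = (\<Sum>k\<in>?S. f k * int_iterate UNIV \<sigma> k (single m a (n - k)))"
    by (rule twisted_convolution_sum) (use assms in auto)
  also have "\<dots> = (\<Sum>k\<in>?S. if k = n - m then f k * int_iterate UNIV \<sigma> k a else 0)"
    by (rule sum.cong) (auto simp: single_def iterate_zero[OF \<sigma>])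
  also have "\<dots> = f (n - m) * int_iterate UNIV \<sigma> (n - m) a"
    using assms by (subst sum.delta) auto
  finally show ?thesis .
qed

text \<open>
  The elements whose transforms vanish on the orbit of \<open>\<mu>\<close> form a \<open>\<sigma>\<close>-invariant ideal \<open>J\<close> without
  \<open>1\<close>; the functions with values in \<open>J\<close> form an ideal, which by simplicity is zero.
\<close>

lemma simple_imp_vanishing:
  assumes simple: "simple_algebra (crossed_product \<sigma>)"
    and \<mu>: "\<mu> \<in> character_space" and van: "\<And>k. \<mu> (int_iterate UNIV \<sigma> k b) = 0"
  shows "b = 0"
proof -
  let ?R = "crossed_product \<sigma>"
  interpret R: ring ?R by (rule ring_crossed_product[OF \<sigma>])
  note hom = int_iterate_hom[OF \<sigma>] and char = characterD[OF \<mu>]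
  define J where "J = {a. \<forall>k. \<mu> (int_iterate UNIV \<sigma> k a) = 0}"
  define I where "I = {f \<in> carrier ?R. \<forall>n. f n \<in> J}"
  have J0: "0 \<in> J" by (simp add: J_def iterate_zero[OF \<sigma>] char)
  have Jadd: "x + y \<in> J" if "x \<in> J" "y \<in> J" for x y
    using that by (simp add: J_def hom char)
  have Jmult: "x * y \<in> J" "y * x \<in> J" if "x \<in> J" for x y
    using that by (simp_all add: J_def hom char)
  have Jiter: "int_iterate UNIV \<sigma> m x \<in> J" if "x \<in> J" for x m
    using that by (simp add: J_def flip: int_iterate_add[OF automorphism_bij[OF \<sigma>]])
  have Jsum: "sum g S \<in> J" if "\<And>k. g k \<in> J" for g and S :: "int set"
    by (induction S rule: infinite_finite_induct) (simp_all add: J0 Jadd that)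
  have Jscale: "c *\<^sub>C x \<in> J" if "x \<in> J" for c x
    using Jmult(2)[OF that, of "c *\<^sub>C 1"] by (simp add: mult_scaleC_left)
  have "ideal I ?R"
  proof (rule idealI[OF R.ring_axioms])
    show "subgroup I (add_monoid ?R)"
    proof
      show "I \<subseteq> carrier (add_monoid ?R)" by (auto simp: I_def)
      show "x \<otimes>\<^bsub>add_monoid ?R\<^esub> y \<in> I" if "x \<in> I" "y \<in> I" for x y
        using that R.add.m_closed[of x y] Jadd by (simp add: I_def) (simp add: crossed_product_simps)
      show "\<one>\<^bsub>add_monoid ?R\<^esub> \<in> I"
        using R.zero_closed J0 by (simp add: I_def) (simp add: crossed_product_simps)
      show "inv\<^bsub>add_monoid ?R\<^esub> x \<in> I" if "x \<in> I" for x
      proof -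
        have "(\<lambda>n. - x n) \<in> carrier ?R" "(\<lambda>n. - x n) \<oplus>\<^bsub>?R\<^esub> x = \<zero>\<^bsub>?R\<^esub>"
          using that by (simp_all add: I_def crossed_product_simps)
        then have "inv\<^bsub>add_monoid ?R\<^esub> x = (\<lambda>n. - x n)"
          using R.minus_equality[of "\<lambda>n. - x n" x] that by (simp add: I_def a_inv_def)
        moreover have "- x n \<in> J" for n
          using that Jmult(2)[of "x n" "- 1"] by (simp add: I_def)
        ultimately show ?thesis
          using that \<open>(\<lambda>n. - x n) \<in> carrier ?R\<close> by (simp add: I_def)
      qed
    qed
    show "x \<otimes>\<^bsub>?R\<^esub> f \<in> I" if "f \<in> I" "x \<in> carrier ?R" for f x
    proof -
      have "twisted_convolution \<sigma> x f n \<in> J" for n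
        unfolding twisted_convolution_def
        using that(1) by (intro Jsum Jmult(2) Jiter) (simp add: I_def)
      then show ?thesis
        using that R.m_closed[of x f] by (simp add: I_def) (simp add: crossed_product_simps)
    qed
    show "f \<otimes>\<^bsub>?R\<^esub> x \<in> I" if "f \<in> I" "x \<in> carrier ?R" for f x
    proof -
      have "twisted_convolution \<sigma> f x n \<in> J" for n
        unfolding twisted_convolution_def
        using that(1) by (intro Jsum Jmult(1)) (simp add: I_def)
      then show ?thesis
        using that R.m_closed[of f x] by (simp add: I_def) (simp add: crossed_product_simps)
    qed
  qed
  moreover have "c \<odot>\<^bsub>?R\<^esub> f \<in> I" if "f \<in> I" for c f
  proof -
    have "{n. c *\<^sub>C f n \<noteq> 0} \<subseteq> {n. f n \<noteq> 0}"
      by (auto simp: scaleC_conv_mult[of c 0])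
    then show ?thesis
      using that Jscale by (auto simp: I_def crossed_product_simps intro: finite_subset)
  qed
  ultimately have "I = {\<zero>\<^bsub>?R\<^esub>} \<or> I = carrier ?R"
    using simple by (simp add: simple_algebra_def algebra_ideal_def)
  then show "b = 0"
  proof
    assume I: "I = {\<zero>\<^bsub>?R\<^esub>}"
    have "b \<in> J" using van by (simp add: J_def)
    then have "single 0 b \<in> I"
      using J0 by (auto simp: I_def single_in_carrier) (auto simp: single_def)
    then have "single 0 b 0 = 0" by (simp add: I crossed_product_simps)
    then show ?thesis by (simp add: single_def)
  next
    assume "I = carrier ?R"
    then have "single 0 1 \<in> I" by (simp add: single_in_carrier)
    then have "(single 0 1 :: int \<Rightarrow> 'a) 0 \<in> J" by (simp only: I_def mem_Collect_eq)
    then have "\<mu> 1 = 0" by (simp add: single_def J_def iterate_one[OF \<sigma>])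
    then show ?thesis using char by simp
  qed
qed

text \<open>
  Minimality of the support of \<open>f\<close> is played off against its commutators with coefficients;
  aperiodicity of the characters then leaves a single non-zero coefficient, which is moved to
  position \<open>0\<close>.
\<close>

lemma nonzero_ideal_meets_coefficients:
  assumes ss: "semisimple_algebra TYPE('a)"
    and aper: "\<And>\<mu> n. \<mu> \<in> character_space \<Longrightarrow> n \<noteq> 0 \<Longrightarrow> \<exists>a. \<mu> (int_iterate UNIV \<sigma> n a) \<noteq> \<mu> a"
    and I: "ideal I (crossed_product \<sigma>)" and I0: "I \<noteq> {\<zero>\<^bsub>crossed_product \<sigma>\<^esub>}"
  shows "\<exists>c. c \<noteq> 0 \<and> single 0 c \<in> I"
proof -
  let ?R = "crossed_product \<sigma>" and ?it = "int_iterate UNIV \<sigma>"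
  let ?supp = "\<lambda>f :: int \<Rightarrow> 'a. {n. f n \<noteq> 0}"
  interpret I: ideal I ?R by (rule I)
  note I_add = additive_subgroup.a_closed[OF ideal.axioms(1)[OF I]]
    and I_zero = additive_subgroup.zero_closed[OF ideal.axioms(1)[OF I]]
  have "(\<lambda>n. 0) \<in> I" using I_zero by (simp add: crossed_product_simps)
  then obtain f0 where "f0 \<in> I" "f0 \<noteq> (\<lambda>n. 0)"
    using I0 by (auto simp: crossed_product_simps)
  then obtain f where f: "f \<in> I" "f \<noteq> (\<lambda>n. 0)"
    and least: "\<And>g. g \<in> I \<Longrightarrow> g \<noteq> (\<lambda>n. 0) \<Longrightarrow> card (?supp f) \<le> card (?supp g)"
    using ex_has_least_nat[of "\<lambda>f. f \<in> I \<and> f \<noteq> (\<lambda>n. 0)" f0 "\<lambda>f. card (?supp f)"] by blast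
  have fin: "finite (?supp f)" using I.Icarr[OF f(1)] by (simp add: crossed_product_simps)
  obtain m where m: "f m \<noteq> 0" using f(2) by auto
  have comm: "f n * (a - ?it (n - m) a) = 0" for n a
  proof -
    \<comment> \<open>The twist by \<open>-m\<close> on the right makes the \<open>m\<close>-th coefficients of the two products cancel.\<close>
    define h where "h = (single 0 a \<otimes>\<^bsub>?R\<^esub> f) \<oplus>\<^bsub>?R\<^esub> (f \<otimes>\<^bsub>?R\<^esub> single 0 (- ?it (- m) a))"
    have "h \<in> I"
      unfolding h_def
      by (intro I_add I.I_l_closed I.I_r_closed f single_in_carrier)
    have neg: "?it k (- x) = - ?it k x" for k x
      using int_iterate_hom(1)[OF \<sigma>, of k x "- x"] iterate_zero[OF \<sigma>]
      by (simp add: eq_neg_iff_add_eq_0 add.commute)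
    have hn: "h k = f k * (a - ?it (k - m) a)" for k
    proof -
      have "?it k (?it (- m) a) = ?it (k - m) a"
        by (simp flip: int_iterate_add[OF automorphism_bij[OF \<sigma>]])
      then show ?thesis
        by (simp add: h_def crossed_product_simps convolution_single_left
            convolution_single_right[OF fin] neg algebra_simps)
    qed
    have "h = (\<lambda>n. 0)"
    proof (rule ccontr)
      assume "h \<noteq> (\<lambda>n. 0)"
      then have "card (?supp f) \<le> card (?supp h)" using least \<open>h \<in> I\<close> by blast
      moreover have "?supp h \<subset> ?supp f"
      proof
        show "?supp h \<subseteq> ?supp f" by (auto simp: hn)
        have "h m = 0" by (simp add: hn)
        with m show "?supp h \<noteq> ?supp f" by blast
      qed
      ultimately show False using psubset_card_mono[OF fin] by (meson not_le)
    qed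
    then show ?thesis using hn[of n] by simp
  qed
  have out: "f n = 0" if ne: "n \<noteq> m" for n
  proof (rule semisimple_eq_zero[OF ss])
    fix \<mu> :: "'a \<Rightarrow> complex" assume \<mu>: "\<mu> \<in> character_space"
    obtain a where a: "\<mu> (?it (n - m) a) \<noteq> \<mu> a"
      using aper[OF \<mu>, of "n - m"] ne by auto
    have "\<mu> (f n) * (\<mu> a - \<mu> (?it (n - m) a)) = \<mu> (f n * (a - ?it (n - m) a))"
      by (simp add: characterD[OF \<mu>])
    also have "\<dots> = 0" by (simp add: comm characterD[OF \<mu>])
    finally show "\<mu> (f n) = 0" using a by simp
  qed
  have "f \<otimes>\<^bsub>?R\<^esub> single (- m) 1 = single 0 (f m)"
    by (simp add: fun_eq_iff crossed_product_simps convolution_single_right[OF fin]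
        iterate_one[OF \<sigma>]) (auto simp: single_def out)
  moreover have "f \<otimes>\<^bsub>?R\<^esub> single (- m) 1 \<in> I"
    by (intro I.I_r_closed f single_in_carrier)
  ultimately show ?thesis using m by metis
qed

text \<open>
  The coefficients in an ideal \<open>I\<close> form an ideal \<open>J\<close>, which is \<open>\<sigma>\<close>-invariant because conjugation
  by \<open>single k 1\<close> acts on coefficients as \<open>\<sigma>\<^sup>k\<close>. A character vanishing on \<open>J\<close> thus makes each
  element of \<open>J\<close> vanish on a whole orbit.
\<close>

lemma vanishing_imp_simple:
  assumes ss: "semisimple_algebra TYPE('a)"
    and aper: "\<And>\<mu> n. \<mu> \<in> character_space \<Longrightarrow> n \<noteq> 0 \<Longrightarrow> \<exists>a. \<mu> (int_iterate UNIV \<sigma> n a) \<noteq> \<mu> a"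
    and van: "\<And>\<mu> b. \<mu> \<in> character_space \<Longrightarrow> (\<And>k. \<mu> (int_iterate UNIV \<sigma> k b) = 0) \<Longrightarrow> b = 0"
  shows "simple_algebra (crossed_product \<sigma>)"
  unfolding simple_algebra_def
proof (intro allI impI)
  let ?R = "crossed_product \<sigma>" and ?it = "int_iterate UNIV \<sigma>"
  fix I assume "algebra_ideal I ?R"
  then have ideal: "ideal I ?R" by (simp add: algebra_ideal_def)
  interpret I: ideal I ?R by (rule ideal)
  note I_add = additive_subgroup.a_closed[OF ideal.axioms(1)[OF ideal]]
    and I_zero = additive_subgroup.zero_closed[OF ideal.axioms(1)[OF ideal]]
  define J where "J = {a. single 0 a \<in> I}"
  have Jiter: "?it k a \<in> J" if "a \<in> J" for k a
  proof -
    have "single k 1 \<otimes>\<^bsub>?R\<^esub> single 0 a = single k (?it k a)"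
      by (simp add: fun_eq_iff crossed_product_simps convolution_single_left)
         (auto simp: single_def iterate_zero[OF \<sigma>])
    moreover have "single k (?it k a) \<otimes>\<^bsub>?R\<^esub> single (- k) 1 = single 0 (?it k a)"
      by (auto simp: fun_eq_iff crossed_product_simps iterate_one[OF \<sigma>]
          convolution_single_right[OF finite_support_single]) (auto simp: single_def)
    moreover have "(single k 1 \<otimes>\<^bsub>?R\<^esub> single 0 a) \<otimes>\<^bsub>?R\<^esub> single (- k) 1 \<in> I"
      using that by (intro I.I_r_closed I.I_l_closed single_in_carrier) (simp add: J_def)
    ultimately show ?thesis by (simp add: J_def)
  qed
  show "I = {\<zero>\<^bsub>?R\<^esub>} \<or> I = carrier ?R"
  proof (rule disjCI)
    assume "I \<noteq> carrier ?R"
    then have "1 \<notin> J"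
      using I.one_imp_carrier by (auto simp: J_def one_crossed_product)
    have "proper_ideal J"
      unfolding proper_ideal_def
    proof (intro conjI ballI allI)
      have "single 0 0 = \<zero>\<^bsub>?R\<^esub>" by (auto simp: crossed_product_simps single_def)
      then show "0 \<in> J" using I_zero by (simp add: J_def)
      show "x + y \<in> J" if "x \<in> J" "y \<in> J" for x y
      proof -
        have "single 0 x \<oplus>\<^bsub>?R\<^esub> single 0 y = single 0 (x + y)"
          by (auto simp: crossed_product_simps single_def)
        then show ?thesis using that I_add[of "single 0 x" "single 0 y"] by (simp add: J_def)
      qed
      show "a * x \<in> J" if "x \<in> J" for a x
      proof -
        have "single 0 a \<otimes>\<^bsub>?R\<^esub> single 0 x = single 0 (a * x)"
          by (auto simp: fun_eq_iff crossed_product_simps convolution_single_left)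
             (auto simp: single_def)
        moreover have "single 0 a \<otimes>\<^bsub>?R\<^esub> single 0 x \<in> I"
          using that by (intro I.I_l_closed single_in_carrier) (simp add: J_def)
        ultimately show ?thesis by (simp add: J_def)
      qed
    qed fact
    then obtain \<mu> where \<mu>: "\<mu> \<in> character_space" "\<forall>x\<in>J. \<mu> x = 0"
      using character_vanishing_on_proper_ideal by blast
    have J0: "c = 0" if "c \<in> J" for c
      by (rule van[OF \<mu>(1)]) (use \<mu>(2) Jiter[OF that] in simp)
    then show "I = {\<zero>\<^bsub>?R\<^esub>}"
      using nonzero_ideal_meets_coefficients[OF ss aper ideal] by (force simp: J_def)
  qed
qed

end

theorem theorem5p1:
  fixes \<sigma> :: "'a::complex_comm_banach_algebra \<Rightarrow> 'a"
  assumes "semisimple_algebra TYPE('a)"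
    and "regular_algebra TYPE('a)"
    and "infinite (character_space :: ('a \<Rightarrow> complex) set)"
    and "algebra_automorphism \<sigma>"
  shows "simple_algebra (crossed_product \<sigma>) \<longleftrightarrow>
    minimal_system gelfand_topology (induced_map \<sigma>)"
  unfolding minimal_system_iff_vanishing[OF assms(4,1,2)]
proof
  assume "simple_algebra (crossed_product \<sigma>)"
  then show "\<forall>\<mu>\<in>character_space. \<forall>b. (\<forall>k. \<mu> (int_iterate UNIV \<sigma> k b) = 0) \<longrightarrow> b = 0"
    using simple_imp_vanishing[OF assms(4)] by blast
next
  assume "\<forall>\<mu>\<in>character_space. \<forall>b. (\<forall>k. \<mu> (int_iterate UNIV \<sigma> k b) = 0) \<longrightarrow> b = 0"
  then have van: "b = 0"
    if "\<mu> \<in> character_space" "\<And>k. \<mu> (int_iterate UNIV \<sigma> k b) = 0" for \<mu> b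
    using that by blast
  show "simple_algebra (crossed_product \<sigma>)"
    by (rule vanishing_imp_simple[OF assms(4,1) no_periodic_character[OF assms(4) van assms(3)] van])
qed

end
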